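(* The algebra $\mathbf{Sym}^{(l)}$ is free (as an associative algebra) over the set $\{S_{\mathbf n}:\mathbf n\in\mathbb N^l,\ |\mathbf n|>0\}$. Moreover, $\mathbf{Sym}^{(l)}$ is a Hopf subalgebra of $\mathbf{FQSym}^{(l)}$. The coproduct of the generators is given by $$\Delta S_{\mathbf n}=\sum_{\mathbf i+\mathbf j=\mathbf n}S_{\mathbf i}\otimes S_{\mathbf j},$$ where the sum $\mathbf i+\mathbf j$ is taken in $\mathbb N^l$ (and $\mathbf i,\mathbf j\in\mathbb N^l$). In particular, $\mathbf{Sym}^{(l)}$ is cocommutative.
   Context: Here $\mathbb N=\{0,1,2,\dots\}$. Fix an integer $l\ge1$ and a set of colors $C=\{c_0,\dots,c_{l-1}\}$. A colored permutation of size $n\ge0$ is a pair $(\sigma,u)$ with $\sigma\in\mathfrak S_n$, $u\in C^n$ (permutations are written as words; color words are indexed by positions). $\mathrm{Std}$ denotes the usual standardization of words: the occurrences of the smallest letter are numbered $1,2,\dots$ from left to right, then those of the next smallest letter, etc. $\mathbf{FQSym}^{(l)}$ is the graded Hopf algebra over $\mathbb C$ with basis $(\mathbf G_{\sigma,u})$ indexed by all colored permutations (degree = size), with product $$\mathbf G_{\sigma',u'}\mathbf G_{\sigma'',u''}=\sum_{\sigma\in\sigma'*\sigma''}\mathbf G_{\sigma,u'\cdot u''},$$ where $u'\cdot u''$ is concatenation and $\sigma'*\sigma''$ is the set of permutations $\tau$ of size $|\sigma'|+|\sigma''|$ whose first $|\sigma'|$ letters standardize to $\sigma'$ and whose remaining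 letters standardize to $\sigma''$; and coproduct $$\Delta\mathbf G_{\sigma,u}=\sum_{i=0}^n\mathbf G_{(\sigma,u)_{[1,i]}}\otimes\mathbf G_{(\sigma,u)_{[i+1,n]}},$$ where $n$ is the size of $\sigma$ and $(\sigma,u)_{[a,b]}=(\mathrm{Std}(\sigma'),u')$, with $\sigma'$ the subword of $\sigma$ consisting of the letters (values) in $[a,b]$ and $u'$ the subword of $u$ at the same positions. For $\mathbf n=(n_0,\dots,n_{l-1})\in\mathbb N^l$ with weight $|\mathbf n|=\sum_i n_i=n$, the level $l$ complete homogeneous symmetric function is $$S_{\mathbf n}=\sum_{u\in C^n;\ |u|_i=n_i\ \forall i}\mathbf G_{12\cdots n,\,u},$$ where $|u|_i$ is the number of occurrences of the color $c_i$ in $u$; by convention $S_{\mathbf 0}=1$. $\mathbf{Sym}^{(l)}$ is the subalgebra of $\mathbf{FQSym}^{(l)}$ generated by all the $S_{\mathbf n}$. *)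

theory Defs
  imports Complex_Main "HOL-Library.Poly_Mapping" "HOL-Combinatorics.Multiset_Permutations"
begin

section \<open>Complex vector spaces with a distinguished basis\<close>

text \<open>
  \<^typ>\<open>'b \<Rightarrow>\<^sub>0 complex\<close> is the vector space with basis \<^typ>\<open>'b\<close>; the basis vector of \<open>b\<close> is
  \<open>Poly_Mapping.single b 1\<close>. The tensor product of the spaces with bases \<^typ>\<open>'a\<close> and \<^typ>\<open>'b\<close>
  is the space with basis \<^typ>\<open>'a \<times> 'b\<close>.
\<close>

type_synonym 'b vec = "'b \<Rightarrow>\<^sub>0 complex"

definition vscale :: "complex \<Rightarrow> 'b vec \<Rightarrow> 'b vec" where
  "vscale c x = Poly_Mapping.map ((*) c) x"

lemma lookup_vscale: "Poly_Mapping.lookup (vscale c x) b = c * Poly_Mapping.lookup x b"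
  by (simp add: vscale_def Poly_Mapping.map.rep_eq when_def)

interpretation vec: vector_space "vscale :: complex \<Rightarrow> 'b vec \<Rightarrow> 'b vec"
  by unfold_locales
    (auto intro!: poly_mapping_eqI simp: lookup_vscale Poly_Mapping.lookup_add algebra_simps)

abbreviation vlinear :: "('a vec \<Rightarrow> 'b vec) \<Rightarrow> bool" where
  "vlinear \<equiv> Vector_Spaces.linear vscale vscale"

definition lin_ext :: "('a \<Rightarrow> 'b vec) \<Rightarrow> 'a vec \<Rightarrow> 'b vec" where
  "lin_ext f x = (\<Sum>a\<in>Poly_Mapping.keys x. vscale (Poly_Mapping.lookup x a) (f a))"

definition bilin_ext :: "('a \<Rightarrow> 'b \<Rightarrow> 'd vec) \<Rightarrow> 'a vec \<Rightarrow> 'b vec \<Rightarrow> 'd vec" where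
  "bilin_ext f x y = lin_ext (\<lambda>a. lin_ext (f a) y) x"

definition tensor :: "'a vec \<Rightarrow> 'b vec \<Rightarrow> ('a \<times> 'b) vec" (infixr "\<otimes>" 71) where
  "x \<otimes> y = bilin_ext (\<lambda>a b. Poly_Mapping.single (a, b) 1) x y"

definition tensor_space :: "'a vec set \<Rightarrow> 'b vec set \<Rightarrow> ('a \<times> 'b) vec set" where
  "tensor_space A B = vec.span {x \<otimes> y |x y. x \<in> A \<and> y \<in> B}"

definition twist :: "('a \<times> 'b) vec \<Rightarrow> ('b \<times> 'a) vec" where
  "twist = lin_ext (\<lambda>(a, b). Poly_Mapping.single (b, a) 1)"

section \<open>Colored permutations\<close>

text \<open>
  Permutations are words on \<open>1, \<dots>, n\<close>. The color set \<open>C\<close> is a type \<^typ>\<open>'c\<close>, which the later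
  definitions require to be finite; thus \<open>l = CARD('c)\<close> is arbitrary with \<open>l \<ge> 1\<close>, and
  \<^typ>\<open>'c \<Rightarrow> nat\<close> is the set of \<open>l\<close>-tuples of natural numbers.
\<close>

typedef 'c cperm =
  "{(\<sigma> :: nat list, u :: 'c list). \<sigma> \<in> permutations_of_set {1..length \<sigma>} \<and> length u = length \<sigma>}"
  by (rule exI[of _ "([], [])"]) simp

definition std :: "nat list \<Rightarrow> nat list" where
  "std w = map (\<lambda>i. card {j. j < length w \<and> (w ! j < w ! i \<or> (w ! j = w ! i \<and> j \<le> i))})
             [0..<length w]"

lemma std_permutation: "std w \<in> permutations_of_set {1..length w}"
proof -
  define n where "n = length w"
  define A where "A i = {j. j < n \<and> (w ! j < w ! i \<or> (w ! j = w ! i \<and> j \<le> i))}" for i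
  have fin: "finite (A i)" for i
    by (simp add: A_def)
  have std: "std w = map (\<lambda>i. card (A i)) [0..<n]"
    by (simp add: std_def A_def n_def)
  have neq: "card (A i) \<noteq> card (A j)" if "i < n" "j < n" "i \<noteq> j" for i j
  proof -
    have "(w ! i < w ! j \<or> w ! i = w ! j \<and> i < j) \<or> (w ! j < w ! i \<or> w ! j = w ! i \<and> j < i)"
      using \<open>i \<noteq> j\<close> by linarith
    then show ?thesis
    proof (rule disjE)
      assume 1: "w ! i < w ! j \<or> w ! i = w ! j \<and> i < j"
      have "A i \<subset> A j"
      proof
        show "A i \<subseteq> A j" using 1 by (auto simp: A_def)
        have "j \<in> A j" "j \<notin> A i" using 1 that by (auto simp: A_def)
        then show "A i \<noteq> A j" by blast
      qed
      from psubset_card_mono[OF fin this] show ?thesis by simp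
    next
      assume 2: "w ! j < w ! i \<or> w ! j = w ! i \<and> j < i"
      have "A j \<subset> A i"
      proof
        show "A j \<subseteq> A i" using 2 by (auto simp: A_def)
        have "i \<in> A i" "i \<notin> A j" using 2 that by (auto simp: A_def)
        then show "A j \<noteq> A i" by blast
      qed
      from psubset_card_mono[OF fin this] show ?thesis by simp
    qed
  qed
  have inj: "inj_on (\<lambda>i. card (A i)) {0..<n}"
  proof (rule inj_onI)
    fix i j assume "i \<in> {0..<n}" "j \<in> {0..<n}" "card (A i) = card (A j)"
    then show "i = j" using neq[of i j] by (cases "i = j") simp_all
  qed
  have sub: "(\<lambda>i. card (A i)) ` {0..<n} \<subseteq> {1..n}"
  proof (rule image_subsetI)
    fix i assume "i \<in> {0..<n}"
    then have "i \<in> A i" by (simp add: A_def)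
    then have "card (A i) > 0" using fin[of i] by (auto simp: card_gt_0_iff)
    moreover have "card (A i) \<le> card {..<n}"
      by (rule card_mono) (auto simp: A_def)
    ultimately show "card (A i) \<in> {1..n}" by simp
  qed
  have "(\<lambda>i. card (A i)) ` {0..<n} = {1..n}"
    using sub by (rule card_subset_eq[rotated]) (simp_all add: card_image[OF inj])
  then show ?thesis
    using inj by (simp add: std permutations_of_set_def distinct_map n_def)
qed

definition convolution :: "nat list \<Rightarrow> nat list \<Rightarrow> nat list set" where
  "convolution \<sigma>' \<sigma>'' = {\<tau> \<in> permutations_of_set {1..length \<sigma>' + length \<sigma>''}.
     std (take (length \<sigma>') \<tau>) = \<sigma>' \<and> std (drop (length \<sigma>') \<tau>) = \<sigma>''}"

definition restrict_values :: "nat list \<Rightarrow> 'c list \<Rightarrow> nat \<Rightarrow> nat \<Rightarrow> nat list \<times> 'c list" where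
  "restrict_values \<sigma> u a b =
     (let w = filter (\<lambda>(v, c). v \<in> {a..b}) (zip \<sigma> u) in (std (map fst w), map snd w))"

section \<open>The Hopf algebra of colored free quasi-symmetric functions\<close>

type_synonym 'c fqsym = "'c cperm vec"

text \<open>Only meaningful if \<open>(\<sigma>, u)\<close> is a colored permutation, as is the case in all uses below.\<close>

definition G :: "nat list \<Rightarrow> 'c list \<Rightarrow> 'c fqsym" where
  "G \<sigma> u = Poly_Mapping.single (Abs_cperm (\<sigma>, u)) 1"

definition fq_mult :: "'c fqsym \<Rightarrow> 'c fqsym \<Rightarrow> 'c fqsym" (infixl "\<odot>" 70) where
  "x \<odot> y = bilin_ext (\<lambda>p q. case (Rep_cperm p, Rep_cperm q) of
     ((\<sigma>', u'), (\<sigma>'', u'')) \<Rightarrow> \<Sum>\<sigma>\<in>convolution \<sigma>' \<sigma>''. G \<sigma> (u' @ u'')) x y"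

definition fq_one :: "'c fqsym" where
  "fq_one = G [] []"

definition fq_comult :: "'c fqsym \<Rightarrow> ('c cperm \<times> 'c cperm) vec" ("\<Delta>") where
  "\<Delta> = lin_ext (\<lambda>p. case Rep_cperm p of (\<sigma>, u) \<Rightarrow>
     \<Sum>i\<in>{0..length \<sigma>}. case_prod G (restrict_values \<sigma> u 1 i)
        \<otimes> case_prod G (restrict_values \<sigma> u (i + 1) (length \<sigma>)))"

text \<open>The counit, which is the projection to degree 0.\<close>

definition fq_counit :: "'c fqsym \<Rightarrow> complex" where
  "fq_counit x = Poly_Mapping.lookup x (Abs_cperm ([], []))"

text \<open>The convolution \<open>\<mu> \<circ> (f \<otimes> g) \<circ> \<Delta>\<close> of linear endomorphisms.\<close>

definition conv_prod :: "('c fqsym \<Rightarrow> 'c fqsym) \<Rightarrow> ('c fqsym \<Rightarrow> 'c fqsym) \<Rightarrow> 'c fqsym \<Rightarrow> 'c fqsym" where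
  "conv_prod f g x =
     lin_ext (\<lambda>(p, q). f (Poly_Mapping.single p 1) \<odot> g (Poly_Mapping.single q 1)) (\<Delta> x)"

definition is_antipode :: "('c fqsym \<Rightarrow> 'c fqsym) \<Rightarrow> bool" where
  "is_antipode S \<longleftrightarrow> vlinear S \<and>
     (\<forall>x. conv_prod S id x = vscale (fq_counit x) fq_one) \<and>
     (\<forall>x. conv_prod id S x = vscale (fq_counit x) fq_one)"

definition subalgebra :: "'c fqsym set \<Rightarrow> bool" where
  "subalgebra A \<longleftrightarrow> vec.subspace A \<and> fq_one \<in> A \<and> (\<forall>x\<in>A. \<forall>y\<in>A. x \<odot> y \<in> A)"

text \<open>An antipode is unique, being a two-sided convolution inverse of the identity.\<close>

definition hopf_subalgebra :: "'c fqsym set \<Rightarrow> bool" where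
  "hopf_subalgebra A \<longleftrightarrow> subalgebra A \<and> \<Delta> ` A \<subseteq> tensor_space A A \<and>
     (\<exists>S. is_antipode S \<and> S ` A \<subseteq> A)"

definition cocommutative :: "'c fqsym set \<Rightarrow> bool" where
  "cocommutative A \<longleftrightarrow> (\<forall>x\<in>A. twist (\<Delta> x) = \<Delta> x)"

section \<open>Freeness\<close>

text \<open>The free associative algebra over \<open>X\<close> has as basis the words over \<open>X\<close>.\<close>

definition free_algebra :: "'x set \<Rightarrow> 'x list vec set" where
  "free_algebra X = {f. Poly_Mapping.keys f \<subseteq> lists X}"

definition free_mult :: "'x list vec \<Rightarrow> 'x list vec \<Rightarrow> 'x list vec" where
  "free_mult f g = bilin_ext (\<lambda>v w. Poly_Mapping.single (v @ w) 1) f g"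

text \<open>
  \<open>A\<close> is free over \<open>X\<close> if there is an algebra isomorphism from the free algebra over \<open>X\<close> to \<open>A\<close>
  that maps each generator to itself. The values of \<open>\<phi>\<close> outside of \<open>free_algebra X\<close> are irrelevant;
  a linear map on this subspace always extends linearly to the whole type.
\<close>

definition free_over :: "'c fqsym set \<Rightarrow> 'c fqsym set \<Rightarrow> bool" where
  "free_over A X \<longleftrightarrow> (\<exists>\<phi>. vlinear \<phi> \<and>
     \<phi> (Poly_Mapping.single [] 1) = fq_one \<and>
     (\<forall>f\<in>free_algebra X. \<forall>g\<in>free_algebra X. \<phi> (free_mult f g) = \<phi> f \<odot> \<phi> g) \<and>
     (\<forall>x\<in>X. \<phi> (Poly_Mapping.single [x] 1) = x) \<and>
     bij_betw \<phi> (free_algebra X) A)"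

section \<open>Noncommutative symmetric functions of level \<open>l\<close>\<close>

definition weight :: "('c::finite \<Rightarrow> nat) \<Rightarrow> nat" where
  "weight n = (\<Sum>c\<in>UNIV. n c)"

definition complete_S :: "('c::finite \<Rightarrow> nat) \<Rightarrow> 'c fqsym" where
  "complete_S n = (\<Sum>u | length u = weight n \<and> (\<forall>c. count_list u c = n c). G [1..<weight n + 1] u)"

definition Sym :: "'c::finite fqsym set" where
  "Sym = subalgebra hull (range complete_S)"

end

(*
  A sum of basis elements is best described by its coefficients. On the level of coefficients the
  product is the deconcatenation of colored permutations (followed by standardization), and the
  coproduct is the shifted shuffle. A shuffle is encoded by the mask of the positions of its small
  letters, and a mask for a concatenation is a concatenation of masks; this makes the coproduct
  multiplicative. Cocommutativity and closedness of Sym under the coproduct then only need to be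
  checked on the generators. The antipode is the geometric series of the convolution powers of
  eta eps - id, which terminates in each degree and preserves every subalgebra closed under the
  coproduct. For freeness, a word in the generators of length k is detected by a permutation
  consisting of k increasing blocks with descents in between: it has coefficient 1 in the product
  along this word and 0 in the product along any other word of length at most k.
*)
theory Submission
  imports Defs
begin

section \<open>Standardization\<close>

text \<open>A subword of a permutation is in general not a permutation, so every piece cut off in a
  product or coproduct would call for another standardization. A colored permutation is therefore
  handled as the class of all colored words, repeated letters allowed, with a given order pattern
  and given colors. Cutting by position respects these classes, cutting by value does so once the
  threshold is adjusted, and each argument can pick a convenient representative: a shifted word for
  shuffles, a constant word for the identity, constant blocks with falling letters for freeness.
  Freeness needs a leading term argument because products with different numbers of factors overlap:
  for l = 1 the identity of size 2 occurs in S_1 S_1 as well as in S_2. The number of factors orders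
  the words, since a product of k generators only contains permutations with at most k - 1 descents;
  a permutation with k - 1 descents is invisible to shorter words.\<close>

lemma length_std [simp]: "length (std w) = length w"
  by (simp add: std_def)

text \<open>Equal letters are numbered from left to right, so the weak comparison survives only when
  the left position comes first; for \<open>i > j\<close> and equal letters it would fail.\<close>

lemma std_nth_le_iff:
  assumes "i < j" "j < length w"
  shows "std w ! i \<le> std w ! j \<longleftrightarrow> w ! i \<le> w ! j"
proof -
  define A where "A i = {k. k < length w \<and> (w ! k < w ! i \<or> (w ! k = w ! i \<and> k \<le> i))}" for i
  have fin: "finite (A k)" for k
    by (simp add: A_def)
  have eq: "std w ! k = card (A k)" if "k < length w" for k
    using that by (simp add: std_def A_def)
  show ?thesis
  proof (cases "w ! i \<le> w ! j")
    case True
    then have "A i \<subseteq> A j"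
      using assms by (auto simp: A_def)
    then show ?thesis
      using True assms eq card_mono[OF fin] by simp
  next
    case False
    then have "A j \<subseteq> A i" "i \<in> A i" "i \<notin> A j"
      using assms by (auto simp: A_def)
    then have "A j \<subset> A i"
      by blast
    then show ?thesis
      using False assms eq psubset_card_mono[OF fin] by (simp add: not_le)
  qed
qed

text \<open>The rank of a position depends only on comparisons with other positions, and a
  comparison from right to left is the negation of the one from left to right.\<close>

lemma std_eq_iff:
  "std v = std w \<longleftrightarrow> length v = length w \<and>
     (\<forall>i j. i < j \<and> j < length w \<longrightarrow> (v ! i \<le> v ! j \<longleftrightarrow> w ! i \<le> w ! j))"
proof (intro iffI)
  assume eq: "std v = std w"
  then have "length v = length w"
    using length_std by metis
  then show "length v = length w \<and>
     (\<forall>i j. i < j \<and> j < length w \<longrightarrow> (v ! i \<le> v ! j \<longleftrightarrow> w ! i \<le> w ! j))"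
    using eq std_nth_le_iff by metis
next
  assume R: "length v = length w \<and>
     (\<forall>i j. i < j \<and> j < length w \<longrightarrow> (v ! i \<le> v ! j \<longleftrightarrow> w ! i \<le> w ! j))"
  have "(v ! j < v ! i \<or> v ! j = v ! i \<and> j \<le> i) \<longleftrightarrow> (w ! j < w ! i \<or> w ! j = w ! i \<and> j \<le> i)"
    if "i < length w" "j < length w" for i j
  proof (cases i j rule: linorder_cases)
    case less
    then have "v ! i \<le> v ! j \<longleftrightarrow> w ! i \<le> w ! j"
      using R that by blast
    then show ?thesis
      using less by linarith
  next
    case greater
    then have "v ! j \<le> v ! i \<longleftrightarrow> w ! j \<le> w ! i"
      using R that by blast
    then show ?thesis
      using greater by linarith
  qed simp
  then show "std v = std w"
    using R unfolding std_def by (intro map_cong arg_cong[where f = card] Collect_cong) auto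
qed

lemma std_permutation_id:
  assumes "\<sigma> \<in> permutations_of_set {1..length \<sigma>}"
  shows "std \<sigma> = \<sigma>"
proof (rule nth_equalityI)
  fix i assume "i < length (std \<sigma>)"
  then have i: "i < length \<sigma>"
    by simp
  have dist: "distinct \<sigma>" and set: "set \<sigma> = {1..length \<sigma>}"
    using assms by (auto simp: permutations_of_set_def)
  have "\<sigma> ! i \<in> {1..length \<sigma>}"
    using i set nth_mem by blast
  define B where "B = {j. j < length \<sigma> \<and> \<sigma> ! j \<le> \<sigma> ! i}"
  have "std \<sigma> ! i = card B"
    unfolding B_def std_def using i dist
    by (auto intro!: arg_cong[where f = card] simp: nth_eq_iff_index_eq)
  also have "\<dots> = card ((!) \<sigma> ` B)"
    using dist by (intro card_image[symmetric] inj_onI) (auto simp: B_def nth_eq_iff_index_eq)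
  also have "(!) \<sigma> ` B = {x \<in> set \<sigma>. x \<le> \<sigma> ! i}"
    by (auto simp: B_def in_set_conv_nth)
  also have "\<dots> = {1..\<sigma> ! i}"
    using set \<open>\<sigma> ! i \<in> {1..length \<sigma>}\<close> by auto
  finally show "std \<sigma> ! i = \<sigma> ! i"
    by simp
qed simp

text \<open>Standardization numbers small letters first, so the \<open>k\<close> letters that are at
  most \<open>t\<close> receive exactly the numbers up to \<open>k\<close>. Thus a cut by value may
  be made before standardizing.\<close>

lemma std_nth_threshold:
  assumes "i < length w" "length (filter (\<lambda>x. x \<le> t) w) = k"
  shows "std w ! i \<le> k \<longleftrightarrow> w ! i \<le> t"
proof -
  define A where "A = {j. j < length w \<and> (w ! j < w ! i \<or> (w ! j = w ! i \<and> j \<le> i))}"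
  define B where "B = {j. j < length w \<and> w ! j \<le> t}"
  have fin: "finite A" "finite B"
    by (simp_all add: A_def B_def)
  have A: "std w ! i = card A"
    using assms by (simp add: std_def A_def)
  have B: "k = card B"
    using assms by (simp add: length_filter_conv_card B_def)
  show ?thesis
  proof (cases "w ! i \<le> t")
    case True
    then have "A \<subseteq> B"
      by (auto simp: A_def B_def)
    then show ?thesis
      using True A B fin by (simp add: card_mono)
  next
    case False
    then have "B \<subset> A"
      using assms by (auto simp: A_def B_def)
    then show ?thesis
      using False A B fin by (simp add: psubset_card_mono not_le)
  qed
qed

section \<open>Colored words and colored permutations\<close>

definition cstd :: "(nat \<times> 'c) list \<Rightarrow> 'c cperm" where
  "cstd w = Abs_cperm (std (map fst w), map snd w)"

definition cword :: "'c cperm \<Rightarrow> (nat \<times> 'c) list" where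
  "cword p = (case Rep_cperm p of (\<sigma>, u) \<Rightarrow> zip \<sigma> u)"

abbreviation csize :: "'c cperm \<Rightarrow> nat" where
  "csize p \<equiv> length (cword p)"

lemma Rep_cstd: "Rep_cperm (cstd w) = (std (map fst w), map snd w)"
  unfolding cstd_def using std_permutation[of "map fst w"] by (intro Abs_cperm_inverse) simp

lemma cword_cstd: "cword (cstd w) = zip (std (map fst w)) (map snd w)"
  by (simp add: cword_def Rep_cstd)

lemma csize_cstd [simp]: "csize (cstd w) = length w"
  by (simp add: cword_cstd)

lemma Rep_cperm_cword: "Rep_cperm p = (map fst (cword p), map snd (cword p))"
  using Rep_cperm[of p] by (auto simp: cword_def split: prod.splits)

lemma cword_permutation: "map fst (cword p) \<in> permutations_of_set {1..csize p}"
  using Rep_cperm[of p] unfolding Rep_cperm_cword by simp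

lemma set_cword: "fst ` set (cword p) = {1..csize p}"
  using cword_permutation[of p] by (simp add: permutations_of_set_def)

lemma cword_fst_bounds: "x \<in> set (cword p) \<Longrightarrow> 1 \<le> fst x \<and> fst x \<le> csize p"
  using set_cword[of p] by force

lemma cstd_cword [simp]: "cstd (cword p) = p"
  unfolding cstd_def using std_permutation_id[of "map fst (cword p)"] cword_permutation[of p]
  by (simp add: Rep_cperm_cword[symmetric] Rep_cperm_inverse)

lemma csize_eq_0_iff: "csize p = 0 \<longleftrightarrow> p = cstd []"
  by (metis cstd_cword csize_cstd length_0_conv)

text \<open>Both words are projections of one list \<open>z\<close> of triples carrying the common
  colors. A part of \<open>z\<close> yields corresponding parts of both words at once, so prefixes,
  suffixes, filtered words and merges inherit the relation.\<close>

definition same_order :: "(nat \<times> 'c) list \<Rightarrow> (nat \<times> 'c) list \<Rightarrow> bool" where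
  "same_order v w \<longleftrightarrow> (\<exists>z. v = map (\<lambda>(a, b, c). (a, c)) z \<and> w = map (\<lambda>(a, b, c). (b, c)) z \<and>
     sorted_wrt (\<lambda>(a, b, _) (a', b', _). a \<le> a' \<longleftrightarrow> b \<le> b') z)"

lemma same_orderI:
  assumes "sorted_wrt (\<lambda>(a, b, _) (a', b', _). a \<le> a' \<longleftrightarrow> b \<le> b') z"
  shows "same_order (map (\<lambda>(a, b, c). (a, c)) z) (map (\<lambda>(a, b, c). (b, c)) z)"
  unfolding same_order_def using assms by (intro exI[of _ z]) simp

lemma same_orderE:
  assumes "same_order v w"
  obtains z where "v = map (\<lambda>(a, b, c). (a, c)) z" "w = map (\<lambda>(a, b, c). (b, c)) z"
    "sorted_wrt (\<lambda>(a, b, _) (a', b', _). a \<le> a' \<longleftrightarrow> b \<le> b') z"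
  using assms unfolding same_order_def by (elim exE conjE)

lemma cstd_eq_iff: "cstd v = cstd w \<longleftrightarrow> same_order v w"
proof -
  have "cstd v = cstd w \<longleftrightarrow> std (map fst v) = std (map fst w) \<and> map snd v = map snd w"
    by (metis Pair_inject Rep_cperm_inject Rep_cstd)
  also have "\<dots> \<longleftrightarrow> length v = length w \<and> map snd v = map snd w \<and>
     (\<forall>i j. i < j \<and> j < length w \<longrightarrow> (fst (v ! i) \<le> fst (v ! j) \<longleftrightarrow> fst (w ! i) \<le> fst (w ! j)))"
    unfolding std_eq_iff by (auto simp del: less_imp_le)
  also have "\<dots> \<longleftrightarrow> same_order v w"
  proof
    assume *: "length v = length w \<and> map snd v = map snd w \<and>
     (\<forall>i j. i < j \<and> j < length w \<longrightarrow> (fst (v ! i) \<le> fst (v ! j) \<longleftrightarrow> fst (w ! i) \<le> fst (w ! j)))"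
    then have snd: "snd (v ! i) = snd (w ! i)" if "i < length w" for i
      using that by (metis nth_map)
    let ?z = "map (\<lambda>i. (fst (v ! i), fst (w ! i), snd (w ! i))) [0..<length w]"
    have z: "map (\<lambda>(a, b, c). (a, c)) ?z = v" "map (\<lambda>(a, b, c). (b, c)) ?z = w"
      using * snd by (auto intro!: nth_equalityI prod_eqI simp: case_prod_unfold)
    have "sorted_wrt (\<lambda>(a, b, _) (a', b', _). a \<le> a' \<longleftrightarrow> b \<le> b') ?z"
      using * by (simp add: sorted_wrt_iff_nth_less case_prod_unfold)
    from same_orderI[OF this] show "same_order v w"
      unfolding z .
  next
    assume "same_order v w"
    then show "length v = length w \<and> map snd v = map snd w \<and>
     (\<forall>i j. i < j \<and> j < length w \<longrightarrow> (fst (v ! i) \<le> fst (v ! j) \<longleftrightarrow> fst (w ! i) \<le> fst (w ! j)))"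
      by (elim same_orderE) (simp add: case_prod_unfold sorted_wrt_iff_nth_less)
  qed
  finally show ?thesis .
qed

lemma same_order_take: "same_order v w \<Longrightarrow> same_order (take k v) (take k w)"
  by (elim same_orderE) (simp only: take_map same_orderI sorted_wrt_take)

lemma same_order_drop: "same_order v w \<Longrightarrow> same_order (drop k v) (drop k w)"
  by (elim same_orderE) (simp only: drop_map same_orderI sorted_wrt_drop)

lemma same_order_filter:
  assumes "same_order v w" "\<And>i. i < length w \<Longrightarrow> P (v ! i) \<longleftrightarrow> Q (w ! i)"
  shows "same_order (filter P v) (filter Q w)"
proof -
  obtain z where z: "v = map (\<lambda>(a, b, c). (a, c)) z" "w = map (\<lambda>(a, b, c). (b, c)) z"
     "sorted_wrt (\<lambda>(a, b, _) (a', b', _). a \<le> a' \<longleftrightarrow> b \<le> b') z"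
    using assms(1) by (rule same_orderE)
  have *: "P ((\<lambda>(a, b, c). (a, c)) x) \<longleftrightarrow> Q ((\<lambda>(a, b, c). (b, c)) x)" if "x \<in> set z" for x
    using assms(2) that by (auto simp: z(1,2) in_set_conv_nth)
  have "filter P v = map (\<lambda>(a, b, c). (a, c)) (filter (P \<circ> (\<lambda>(a, b, c). (a, c))) z)"
    by (simp add: z filter_map)
  moreover have "filter Q w = map (\<lambda>(a, b, c). (b, c)) (filter (P \<circ> (\<lambda>(a, b, c). (a, c))) z)"
    using * by (auto simp: z(2) filter_map intro!: arg_cong[where f = "map _"] filter_cong)
  ultimately show ?thesis
    using same_orderI[OF sorted_wrt_filter[OF z(3)]] by metis
qed

lemma same_order_cword: "same_order (cword (cstd w)) w"
  by (simp add: cstd_eq_iff[symmetric])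

section \<open>Cutting colored permutations by position and by value\<close>

definition ctake :: "nat \<Rightarrow> 'c cperm \<Rightarrow> 'c cperm" where
  "ctake k p = cstd (take k (cword p))"

definition cdrop :: "nat \<Rightarrow> 'c cperm \<Rightarrow> 'c cperm" where
  "cdrop k p = cstd (drop k (cword p))"

definition low :: "nat \<Rightarrow> 'c cperm \<Rightarrow> 'c cperm" where
  "low k p = cstd (filter (\<lambda>x. fst x \<le> k) (cword p))"

definition high :: "nat \<Rightarrow> 'c cperm \<Rightarrow> 'c cperm" where
  "high k p = cstd (filter (\<lambda>x. \<not> fst x \<le> k) (cword p))"

lemma ctake_cstd: "ctake k (cstd w) = cstd (take k w)"
  unfolding ctake_def cstd_eq_iff by (intro same_order_take same_order_cword)

lemma cdrop_cstd: "cdrop k (cstd w) = cstd (drop k w)"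
  unfolding cdrop_def cstd_eq_iff by (intro same_order_drop same_order_cword)

lemma csize_ctake [simp]: "csize (ctake k p) = min (csize p) k"
  by (simp add: ctake_def)

lemma csize_cdrop [simp]: "csize (cdrop k p) = csize p - k"
  by (simp add: cdrop_def)

lemma cword_cstd_threshold:
  assumes "i < length w" "length (filter (\<lambda>x. fst x \<le> t) w) = k"
  shows "fst (cword (cstd w) ! i) \<le> k \<longleftrightarrow> fst (w ! i) \<le> t"
  using std_nth_threshold[of i "map fst w" t k] assms by (simp add: cword_cstd filter_map comp_def)

lemma low_cstd:
  assumes "length (filter (\<lambda>x. fst x \<le> t) w) = k"
  shows "low k (cstd w) = cstd (filter (\<lambda>x. fst x \<le> t) w)"
  unfolding low_def cstd_eq_iff using cword_cstd_threshold[OF _ assms]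
  by (intro same_order_filter same_order_cword)

lemma high_cstd:
  assumes "length (filter (\<lambda>x. fst x \<le> t) w) = k"
  shows "high k (cstd w) = cstd (filter (\<lambda>x. \<not> fst x \<le> t) w)"
  unfolding high_def cstd_eq_iff using cword_cstd_threshold[OF _ assms]
  by (intro same_order_filter same_order_cword) simp_all

lemma length_filter_cword:
  assumes "k \<le> csize p"
  shows "length (filter (\<lambda>x. fst x \<le> k) (cword p)) = k"
proof -
  have *: "distinct (map fst (cword p))" "set (map fst (cword p)) = {1..csize p}"
    using cword_permutation[of p] by (auto simp: permutations_of_set_def)
  have "length (filter (\<lambda>x. fst x \<le> k) (cword p)) = length (filter (\<lambda>x. x \<le> k) (map fst (cword p)))"
    by (simp add: filter_map comp_def)
  also have "\<dots> = card (set (filter (\<lambda>x. x \<le> k) (map fst (cword p))))"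
    using * by (metis distinct_card distinct_filter)
  also have "set (filter (\<lambda>x. x \<le> k) (map fst (cword p))) = {1..k}"
    unfolding set_filter *(2) using assms by auto
  finally show ?thesis
    by simp
qed

lemma csize_low: "k \<le> csize p \<Longrightarrow> csize (low k p) = k"
  by (simp add: low_def length_filter_cword)

lemma csize_high: "k \<le> csize p \<Longrightarrow> csize (high k p) = csize p - k"
  using sum_length_filter_compl[of "\<lambda>x. fst x \<le> k" "cword p"]
  by (simp add: high_def length_filter_cword)

lemma low_low:
  assumes "j \<le> i" "i \<le> csize p"
  shows "low j (low i p) = low j p"
proof -
  have *: "filter (\<lambda>x. fst x \<le> j) (filter (\<lambda>x. fst x \<le> i) (cword p)) = filter (\<lambda>x. fst x \<le> j) (cword p)"
    using assms by (auto intro!: filter_cong)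
  show ?thesis
    unfolding low_def[of i] using assms
    by (subst low_cstd[where t = j]) (simp_all only: * length_filter_cword low_def le_trans)
qed

text \<open>With \<open>low_low\<close> and \<open>high_high\<close> this is coassociativity on
  basis elements: two cuts by value give the same three pieces in either order. After
  \<open>high j\<close> the values are renumbered from 1, which turns the cut at \<open>i\<close>
  into one at \<open>i - j\<close>.\<close>

lemma high_low:
  assumes "j \<le> i" "i \<le> csize p"
  shows "high j (low i p) = low (i - j) (high j p)"
proof -
  have 1: "filter (\<lambda>x. fst x \<le> j) (filter (\<lambda>x. fst x \<le> i) (cword p)) = filter (\<lambda>x. fst x \<le> j) (cword p)"
    using assms by (auto intro!: filter_cong)
  have 2: "high j (low i p) = cstd (filter (\<lambda>x. \<not> fst x \<le> j) (filter (\<lambda>x. fst x \<le> i) (cword p)))"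
    unfolding low_def[of i] using assms
    by (subst high_cstd[where t = j]) (simp_all only: 1 length_filter_cword le_trans)
  have 3: "filter (\<lambda>x. \<not> fst x \<le> j) (filter (\<lambda>x. fst x \<le> i) (cword p)) =
           filter (\<lambda>x. fst x \<le> i) (filter (\<lambda>x. \<not> fst x \<le> j) (cword p))"
    by (simp add: conj_commute)
  have "length (filter (\<lambda>x. fst x \<le> j) (filter (\<lambda>x. fst x \<le> i) (cword p))) +
     length (filter (\<lambda>x. \<not> fst x \<le> j) (filter (\<lambda>x. fst x \<le> i) (cword p))) = i"
    unfolding sum_length_filter_compl using assms by (simp add: length_filter_cword)
  then have "length (filter (\<lambda>x. fst x \<le> i) (filter (\<lambda>x. \<not> fst x \<le> j) (cword p))) = i - j"
    unfolding 1 3 using assms by (simp only: length_filter_cword le_trans)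
  then have "low (i - j) (high j p) = cstd (filter (\<lambda>x. fst x \<le> i) (filter (\<lambda>x. \<not> fst x \<le> j) (cword p)))"
    unfolding high_def[of j] by (rule low_cstd)
  then show ?thesis
    unfolding 2 3 ..
qed

lemma high_high:
  assumes "i + j \<le> csize p"
  shows "high j (high i p) = high (i + j) p"
proof -
  have 1: "filter (\<lambda>x. fst x \<le> i) (filter (\<lambda>x. fst x \<le> i + j) (cword p)) = filter (\<lambda>x. fst x \<le> i) (cword p)"
    by (auto intro!: filter_cong)
  have 3: "filter (\<lambda>x. \<not> fst x \<le> i) (filter (\<lambda>x. fst x \<le> i + j) (cword p)) =
           filter (\<lambda>x. fst x \<le> i + j) (filter (\<lambda>x. \<not> fst x \<le> i) (cword p))"
    by (simp add: conj_commute)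
  have "length (filter (\<lambda>x. fst x \<le> i) (filter (\<lambda>x. fst x \<le> i + j) (cword p))) +
     length (filter (\<lambda>x. \<not> fst x \<le> i) (filter (\<lambda>x. fst x \<le> i + j) (cword p))) = i + j"
    unfolding sum_length_filter_compl using assms by (simp add: length_filter_cword)
  moreover have "length (filter (\<lambda>x. fst x \<le> i) (cword p)) = i"
    using assms by (simp add: length_filter_cword)
  ultimately have 2: "length (filter (\<lambda>x. fst x \<le> i + j) (filter (\<lambda>x. \<not> fst x \<le> i) (cword p))) = j"
    unfolding 1 3 by simp
  have "high j (high i p) = cstd (filter (\<lambda>x. \<not> fst x \<le> i + j) (filter (\<lambda>x. \<not> fst x \<le> i) (cword p)))"
    unfolding high_def[of i] by (rule high_cstd[OF 2])
  also have "filter (\<lambda>x. \<not> fst x \<le> i + j) (filter (\<lambda>x. \<not> fst x \<le> i) (cword p)) =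
     filter (\<lambda>x. \<not> fst x \<le> i + j) (cword p)"
    unfolding filter_filter by (auto intro!: filter_cong)
  finally show ?thesis
    by (simp only: high_def)
qed

section \<open>Linear and bilinear extension\<close>

lemma vlinear_iff:
  "vlinear f \<longleftrightarrow> (\<forall>x y. f (x + y) = f x + f y) \<and> (\<forall>c x. f (vscale c x) = vscale c (f x))"
  unfolding Vector_Spaces.linear_iff by (auto intro: vec.vector_space_axioms)

lemma vlinearI:
  assumes "\<And>x y. f (x + y) = f x + f y" "\<And>c x. f (vscale c x) = vscale c (f x)"
  shows "vlinear f"
  using assms by (simp add: vlinear_iff)

lemma vlinear_add: "vlinear f \<Longrightarrow> f (x + y) = f x + f y"
  and vlinear_scale: "vlinear f \<Longrightarrow> f (vscale c x) = vscale c (f x)"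
  by (simp_all add: vlinear_iff)

lemma vlinear_0: "vlinear f \<Longrightarrow> f 0 = 0"
  using vlinear_add[of f 0 0] by simp

lemma vlinear_sum: "vlinear f \<Longrightarrow> f (sum g A) = (\<Sum>a\<in>A. f (g a))"
  by (induction A rule: infinite_finite_induct) (simp_all add: vlinear_0 vlinear_add)

lemma lookup_sum_of_bool:
  "(\<Sum>a\<in>Poly_Mapping.keys x. Poly_Mapping.lookup x a * of_bool (b = a)) = (Poly_Mapping.lookup x b :: complex)"
  by (auto simp: of_bool_def if_distrib sum.delta' in_keys_iff cong: if_cong)

lemma lin_ext_superset:
  assumes "finite A" "Poly_Mapping.keys x \<subseteq> A"
  shows "lin_ext f x = (\<Sum>a\<in>A. vscale (Poly_Mapping.lookup x a) (f a))"
  unfolding lin_ext_def using assms by (intro sum.mono_neutral_left) (auto simp: in_keys_iff)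

lemma lin_ext_single: "lin_ext f (Poly_Mapping.single a c) = vscale c (f a)"
  by (subst lin_ext_superset[of "{a}"]) auto

lemma vlinear_lin_ext: "vlinear (lin_ext (f :: 'a \<Rightarrow> 'b vec))"
proof (rule vlinearI)
  fix x y :: "'a vec"
  let ?A = "Poly_Mapping.keys x \<union> Poly_Mapping.keys y"
  have "lin_ext f (x + y) = (\<Sum>a\<in>?A. vscale (Poly_Mapping.lookup (x + y) a) (f a))"
    by (intro lin_ext_superset Poly_Mapping.keys_add) simp
  also have "\<dots> = lin_ext f x + lin_ext f y"
    by (simp add: lin_ext_superset[of ?A] Poly_Mapping.lookup_add vec.scale_left_distrib sum.distrib)
  finally show "lin_ext f (x + y) = lin_ext f x + lin_ext f y" .
next
  fix c and x :: "'a vec"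
  have "Poly_Mapping.keys (vscale c x) \<subseteq> Poly_Mapping.keys x"
    by (auto simp: in_keys_iff lookup_vscale)
  then show "lin_ext f (vscale c x) = vscale c (lin_ext f x)"
    by (simp add: lin_ext_superset[of "Poly_Mapping.keys x"] lookup_vscale vec.scale_sum_right)
qed

lemma lin_ext_basis: "lin_ext (\<lambda>a. Poly_Mapping.single a 1) x = x"
  by (rule poly_mapping_eqI)
    (simp add: lin_ext_def lookup_sum lookup_vscale lookup_single when_def if_distrib
      in_keys_iff cong: if_cong)

lemma vlinear_eq_lin_ext:
  assumes "vlinear f"
  shows "f x = lin_ext (\<lambda>a. f (Poly_Mapping.single a 1)) x"
proof -
  have "f x = f (lin_ext (\<lambda>a. Poly_Mapping.single a 1) x)"
    by (simp only: lin_ext_basis)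
  then show ?thesis
    using assms by (simp add: lin_ext_def vlinear_sum vlinear_scale)
qed

lemma vlinear_eqI:
  assumes "vlinear f" "vlinear g" "\<And>a. f (Poly_Mapping.single a 1) = g (Poly_Mapping.single a 1)"
  shows "f x = g x"
  using assms by (simp add: vlinear_eq_lin_ext[of f x] vlinear_eq_lin_ext[of g x])

text \<open>
  The index \<open>k\<close> runs through the basis elements (or pairs of them) whose image contains \<open>c\<close>: in
  this form the structure maps turn into their transposes, which avoids sums over preimages.
\<close>

lemma lookup_lin_ext:
  assumes "finite K" "\<And>a. Poly_Mapping.lookup (f a) c = (\<Sum>k\<in>K. of_bool (g k = a))"
  shows "Poly_Mapping.lookup (lin_ext f x) c = (\<Sum>k\<in>K. Poly_Mapping.lookup x (g k))"
proof -
  have "Poly_Mapping.lookup (lin_ext f x) c =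
      (\<Sum>a\<in>Poly_Mapping.keys x. \<Sum>k\<in>K. Poly_Mapping.lookup x a * of_bool (g k = a))"
    by (simp add: lin_ext_def lookup_sum lookup_vscale assms(2) sum_distrib_left)
  also have "\<dots> = (\<Sum>k\<in>K. Poly_Mapping.lookup x (g k))"
    by (subst sum.swap) (simp only: lookup_sum_of_bool)
  finally show ?thesis .
qed

lemma lookup_bilin_ext:
  assumes "finite K"
    "\<And>a b. Poly_Mapping.lookup (f a b) c = (\<Sum>k\<in>K. of_bool (g k = a \<and> h k = b))"
  shows "Poly_Mapping.lookup (bilin_ext f x y) c =
    (\<Sum>k\<in>K. Poly_Mapping.lookup x (g k) * Poly_Mapping.lookup y (h k))"
proof -
  have "Poly_Mapping.lookup (lin_ext (f a) y) c =
      (\<Sum>b\<in>Poly_Mapping.keys y. \<Sum>k\<in>K. of_bool (g k = a) * (Poly_Mapping.lookup y b * of_bool (h k = b)))" for a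
    by (simp add: lin_ext_def lookup_sum lookup_vscale assms(2) sum_distrib_left of_bool_conj mult_ac)
  also have "\<dots> a = (\<Sum>k\<in>K. of_bool (g k = a) * Poly_Mapping.lookup y (h k))" for a
    by (subst sum.swap) (simp only: lookup_sum_of_bool sum_distrib_left[symmetric])
  finally have "Poly_Mapping.lookup (bilin_ext f x y) c =
      (\<Sum>a\<in>Poly_Mapping.keys x. \<Sum>k\<in>K. Poly_Mapping.lookup x a * of_bool (g k = a) * Poly_Mapping.lookup y (h k))"
    by (simp add: bilin_ext_def lin_ext_def[of _ x] lookup_sum lookup_vscale sum_distrib_left mult_ac)
  also have "\<dots> = (\<Sum>k\<in>K. Poly_Mapping.lookup x (g k) * Poly_Mapping.lookup y (h k))"
    by (subst sum.swap) (simp only: lookup_sum_of_bool sum_distrib_right[symmetric])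
  finally show ?thesis .
qed

lemma lookup_tensor:
  "Poly_Mapping.lookup (x \<otimes> y) (p, q) = Poly_Mapping.lookup x p * Poly_Mapping.lookup y q"
  unfolding tensor_def
  by (subst lookup_bilin_ext[where K = "{()}" and g = "\<lambda>_. p" and h = "\<lambda>_. q"])
    (auto simp: lookup_single when_def)

lemma tensor_single: "Poly_Mapping.single p c \<otimes> Poly_Mapping.single q d = Poly_Mapping.single (p, q) (c * d)"
proof (rule poly_mapping_eqI)
  fix k show "Poly_Mapping.lookup (Poly_Mapping.single p c \<otimes> Poly_Mapping.single q d) k =
      Poly_Mapping.lookup (Poly_Mapping.single (p, q) (c * d)) k"
    by (cases k) (auto simp: lookup_tensor lookup_single when_def)
qed

lemma tensor_simps:
  "(x + x') \<otimes> y = x \<otimes> y + x' \<otimes> y" "x \<otimes> (y + y') = x \<otimes> y + x \<otimes> y'"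
  "vscale c x \<otimes> y = vscale c (x \<otimes> y)" "x \<otimes> vscale c y = vscale c (x \<otimes> y)"
  by (auto intro!: poly_mapping_eqI simp: lookup_tensor lookup_vscale Poly_Mapping.lookup_add algebra_simps)

lemma tensor_sum_left: "sum f A \<otimes> y = (\<Sum>a\<in>A. f a \<otimes> y)"
  by (rule vlinear_sum) (simp add: vlinear_iff tensor_simps)

lemma tensor_sum_right: "x \<otimes> sum f A = (\<Sum>a\<in>A. x \<otimes> f a)"
  by (rule vlinear_sum[of "(\<otimes>) x"]) (simp add: vlinear_iff tensor_simps)

lemma vlinear_twist: "vlinear twist"
  unfolding twist_def by (rule vlinear_lin_ext)

lemma lookup_twist: "Poly_Mapping.lookup (twist X) (q, p) = Poly_Mapping.lookup X (p, q)"
  unfolding twist_def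
  by (subst lookup_lin_ext[where K = "{()}" and g = "\<lambda>_. (p, q)"])
    (auto simp: lookup_single when_def split: prod.splits)

lemma twist_tensor: "twist (x \<otimes> y) = y \<otimes> x"
  by (rule poly_mapping_eqI) (auto simp: lookup_twist lookup_tensor)

section \<open>Product\<close>

lemma G_eq_cstd:
  assumes "\<sigma> \<in> permutations_of_set {1..length \<sigma>}" "length u = length \<sigma>"
  shows "G \<sigma> u = Poly_Mapping.single (cstd (zip \<sigma> u)) 1"
  using assms by (simp add: G_def cstd_def std_permutation_id)

lemma fq_one_eq: "fq_one = Poly_Mapping.single (cstd []) 1"
  by (simp add: fq_one_def G_eq_cstd)

text \<open>The convolution set is defined by the standardized prefix and suffix of its members, so
  the pairs whose product contains \<open>r\<close> are found by cutting \<open>r\<close> at each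
  position.\<close>

lemma lookup_mult:
  fixes r :: "'c cperm"
  shows "Poly_Mapping.lookup (x \<odot> y) r =
     (\<Sum>k\<le>csize r. Poly_Mapping.lookup x (ctake k r) * Poly_Mapping.lookup y (cdrop k r))"
  unfolding fq_mult_def
proof (rule lookup_bilin_ext)
  fix p q :: "'c cperm"
  define \<sigma>' u' \<sigma>'' u'' where defs: "\<sigma>' = map fst (cword p)" "u' = map snd (cword p)"
    "\<sigma>'' = map fst (cword q)" "u'' = map snd (cword q)"
  note [simp] = Rep_cperm_cword[of p, folded defs] Rep_cperm_cword[of q, folded defs]
  define n where "n = length \<sigma>'"
  define v where "v = map snd (cword r)"
  define \<rho> where "\<rho> = map fst (cword r)"
  have len: "length u' = n" "length u'' = length \<sigma>''" "length \<sigma>' = n" "csize p = n" "length \<rho> = csize r"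
    "length v = csize r"
    by (simp_all add: defs n_def \<rho>_def v_def)
  have lk: "Poly_Mapping.lookup (G \<sigma> (u' @ u'')) r = of_bool (\<sigma> = \<rho> \<and> u' @ u'' = v)"
    if "\<sigma> \<in> convolution \<sigma>' \<sigma>''" for \<sigma>
  proof -
    from that have perm: "\<sigma> \<in> permutations_of_set {1..n + length \<sigma>''}"
      by (simp add: convolution_def len)
    then have "length \<sigma> = n + length \<sigma>''"
      using length_finite_permutations_of_set by fastforce
    then have "Abs_cperm (\<sigma>, u' @ u'') = r \<longleftrightarrow> (\<sigma>, u' @ u'') = Rep_cperm r"
      using perm len by (subst Rep_cperm_inject[symmetric], subst Abs_cperm_inverse) auto
    then show ?thesis
      by (simp add: G_def Rep_cperm_cword[of r] \<rho>_def v_def lookup_single when_def)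
  qed
  have fin: "finite (convolution \<sigma>' \<sigma>'')"
    by (simp add: convolution_def)
  have eq: "cstd w = p' \<longleftrightarrow> std (map fst w) = map fst (cword p') \<and> map snd w = map snd (cword p')" for w p'
    using Rep_cstd[of w] Rep_cperm_cword[of p'] by (metis Pair_inject Rep_cperm_inject)
  have iff: "\<rho> \<in> convolution \<sigma>' \<sigma>'' \<and> u' @ u'' = v \<longleftrightarrow> n \<le> csize r \<and> ctake n r = p \<and> cdrop n r = q" (is "?L \<longleftrightarrow> ?R")
  proof
    assume L: ?L
    then have "length \<rho> = n + length \<sigma>''"
      using length_finite_permutations_of_set[of \<rho> "{1..n + length \<sigma>''}"] by (simp add: convolution_def len)
    moreover have "std (take n \<rho>) = \<sigma>'" "std (drop n \<rho>) = \<sigma>''"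
      using L by (simp_all add: convolution_def len)
    moreover have "take n v = u'" "drop n v = u''"
      using L len by auto
    ultimately show ?R
      using len by (simp add: ctake_def cdrop_def eq take_map drop_map \<rho>_def v_def defs)
  next
    assume R: ?R
    then have "csize q = csize r - n"
      by auto
    then have "csize r = n + length \<sigma>''"
      using R by (simp add: defs)
    then have "\<rho> \<in> permutations_of_set {1..n + length \<sigma>''}"
      using cword_permutation[of r] by (simp add: \<rho>_def)
    moreover have "std (take n \<rho>) = \<sigma>'" "std (drop n \<rho>) = \<sigma>''" "take n v = u'" "drop n v = u''"
      using R by (simp_all add: ctake_def cdrop_def eq take_map drop_map \<rho>_def v_def defs)
    ultimately show ?L
      by (auto simp: convolution_def len)
  qed
  have "Poly_Mapping.lookup (\<Sum>\<sigma>\<in>convolution \<sigma>' \<sigma>''. G \<sigma> (u' @ u'')) r =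
      (\<Sum>\<sigma>\<in>convolution \<sigma>' \<sigma>''. of_bool (\<sigma> = \<rho> \<and> u' @ u'' = v))"
    by (simp add: lookup_sum lk)
  also have "\<dots> = of_bool (\<rho> \<in> convolution \<sigma>' \<sigma>'' \<and> u' @ u'' = v)"
    using fin by (cases "u' @ u'' = v") (auto simp: of_bool_def)
  also have "\<dots> = (\<Sum>k\<le>csize r. if k = n then of_bool (ctake n r = p \<and> cdrop n r = q) else 0)"
    unfolding iff by (simp add: of_bool_def)
  \<comment> \<open>For \<open>k\<close> up to \<open>csize r\<close> the prefix
    \<open>ctake k r\<close> has size \<open>k\<close>, so only the cut at \<open>n\<close> can
    produce \<open>p\<close>; the other summands vanish.\<close>
  also have "\<dots> = (\<Sum>k\<le>csize r. of_bool (ctake k r = p \<and> cdrop k r = q))"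
  proof (rule sum.cong)
    fix k assume "k \<in> {..csize r}"
    moreover have "csize (ctake k r) = n" if "ctake k r = p"
      using that len by simp
    ultimately show "(if k = n then of_bool (ctake n r = p \<and> cdrop n r = q) else 0) =
        (of_bool (ctake k r = p \<and> cdrop k r = q) :: complex)"
      by auto
  qed simp
  finally show "Poly_Mapping.lookup (case (Rep_cperm p, Rep_cperm q) of
     ((\<sigma>', u'), (\<sigma>'', u'')) \<Rightarrow> \<Sum>\<sigma>\<in>convolution \<sigma>' \<sigma>''. G \<sigma> (u' @ u'')) r =
      (\<Sum>k\<le>csize r. of_bool (ctake k r = p \<and> cdrop k r = q))"
    by simp
qed simp

lemma mult_simps:
  "(x + x') \<odot> y = x \<odot> y + x' \<odot> y" "x \<odot> (y + y') = x \<odot> y + x \<odot> y'"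
  "vscale c x \<odot> y = vscale c (x \<odot> y)" "x \<odot> vscale c y = vscale c (x \<odot> y)"
  "0 \<odot> y = 0" "x \<odot> 0 = 0"
  by (auto intro!: poly_mapping_eqI simp: lookup_mult lookup_vscale Poly_Mapping.lookup_add
      ring_distribs sum.distrib sum_distrib_left mult_ac)

lemma mult_sum_left: "sum f A \<odot> y = (\<Sum>a\<in>A. f a \<odot> y)"
  by (rule vlinear_sum) (simp add: vlinear_iff mult_simps)

lemma mult_sum_right: "x \<odot> sum f A = (\<Sum>a\<in>A. x \<odot> f a)"
  by (rule vlinear_sum[of "(\<odot>) x"]) (simp add: vlinear_iff mult_simps)

lemma lookup_one: "Poly_Mapping.lookup fq_one p = of_bool (csize p = 0)"
  unfolding csize_eq_0_iff by (auto simp: fq_one_eq lookup_single when_def)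

lemma mult_one_left [simp]: "fq_one \<odot> x = x"
proof (rule poly_mapping_eqI)
  fix p
  have "Poly_Mapping.lookup (fq_one \<odot> x) p = (\<Sum>k\<le>csize p. if k = 0 then Poly_Mapping.lookup x (cdrop k p) else 0)"
    unfolding lookup_mult by (intro sum.cong) (auto simp: lookup_one min_def)
  then show "Poly_Mapping.lookup (fq_one \<odot> x) p = Poly_Mapping.lookup x p"
    by (simp add: cdrop_def)
qed

lemma mult_one_right [simp]: "x \<odot> fq_one = x"
proof (rule poly_mapping_eqI)
  fix p
  have "Poly_Mapping.lookup (x \<odot> fq_one) p = (\<Sum>k\<le>csize p. if k = csize p then Poly_Mapping.lookup x (ctake k p) else 0)"
    unfolding lookup_mult by (intro sum.cong) (auto simp: lookup_one)
  then show "Poly_Mapping.lookup (x \<odot> fq_one) p = Poly_Mapping.lookup x p"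
    by (simp add: ctake_def)
qed

text \<open>Two cuts at \<open>j\<close> and \<open>i\<close> with \<open>j \<le> i\<close> are
  described instead by the first cut and the distance to the second. This serves both associativity
  of the product and associativity of convolution.\<close>

lemma sum_triangle:
  fixes n :: nat
  shows "(\<Sum>i\<le>n. \<Sum>j\<le>i. f i j) = (\<Sum>j\<le>n. \<Sum>i\<le>n - j. f (i + j) j)"
  by (simp add: sum.Sigma, rule sum.reindex_bij_witness[of _ "\<lambda>(j, i). (i + j, j)" "\<lambda>(i, j). (j, i - j)"]) auto

text \<open>Both sides sum over all ways to cut \<open>p\<close> into three consecutive
  factors.\<close>

lemma mult_assoc: "(x \<odot> y) \<odot> z = x \<odot> (y \<odot> z)"
proof (rule poly_mapping_eqI)
  fix p
  have "Poly_Mapping.lookup ((x \<odot> y) \<odot> z) p = (\<Sum>i\<le>csize p. \<Sum>j\<le>i. Poly_Mapping.lookup x (ctake j p) *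
      Poly_Mapping.lookup y (cdrop j (ctake i p)) * Poly_Mapping.lookup z (cdrop i p))"
    unfolding lookup_mult sum_distrib_right
    by (intro sum.cong) (auto simp: ctake_def[of _ p] ctake_cstd min_def)
  also have "\<dots> = (\<Sum>j\<le>csize p. \<Sum>i\<le>csize p - j. Poly_Mapping.lookup x (ctake j p) *
      Poly_Mapping.lookup y (cdrop j (ctake (i + j) p)) * Poly_Mapping.lookup z (cdrop (i + j) p))"
    by (rule sum_triangle)
  also have "\<dots> = Poly_Mapping.lookup (x \<odot> (y \<odot> z)) p"
    unfolding lookup_mult sum_distrib_left csize_cdrop
    by (intro sum.cong refl) (simp add: ctake_def[of _ p] cdrop_def[of _ p] ctake_cstd cdrop_cstd drop_take mult_ac)
  finally show "Poly_Mapping.lookup ((x \<odot> y) \<odot> z) p = Poly_Mapping.lookup (x \<odot> (y \<odot> z)) p" .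
qed

section \<open>Coproduct\<close>

lemma comult_single:
  "\<Delta> (Poly_Mapping.single r 1) = (\<Sum>i\<le>csize r. Poly_Mapping.single (low i r, high i r) 1)"
proof -
  have Rep: "case_prod G (Rep_cperm p) = Poly_Mapping.single p 1" for p :: "'a cperm"
    using Rep_cperm_inverse[of p] by (auto simp: G_def split: prod.splits)
  have r: "Rep_cperm r = (map fst (cword r), map snd (cword r))"
    by (rule Rep_cperm_cword)
  have low: "restrict_values (map fst (cword r)) (map snd (cword r)) 1 i = Rep_cperm (low i r)" for i
  proof -
    \<comment> \<open>All letters lie between 1 and \<open>csize r\<close>, so each value interval
      reduces to a single inequality.\<close>
    have "filter (\<lambda>(v, c). v \<in> {1..i}) (cword r) = filter (\<lambda>x. fst x \<le> i) (cword r)"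
      using cword_fst_bounds by (force intro!: filter_cong)
    then show ?thesis
      by (simp add: restrict_values_def zip_map_fst_snd low_def Rep_cstd Let_def)
  qed
  have high: "restrict_values (map fst (cword r)) (map snd (cword r)) (i + 1) (csize r) = Rep_cperm (high i r)" for i
  proof -
    have "filter (\<lambda>(v, c). v \<in> {i + 1..csize r}) (cword r) = filter (\<lambda>x. \<not> fst x \<le> i) (cword r)"
      using cword_fst_bounds by (force intro!: filter_cong)
    then show ?thesis
      by (simp add: restrict_values_def zip_map_fst_snd high_def Rep_cstd Let_def)
  qed
  show ?thesis
    unfolding fq_comult_def lin_ext_single vec.scale_one r prod.case length_map low high Rep tensor_single
    by (simp add: atMost_atLeast0)
qed

lemma vlinear_comult: "vlinear \<Delta>"
  unfolding fq_comult_def by (rule vlinear_lin_ext)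

lemma comult_eq: "\<Delta> x = lin_ext (\<lambda>r. \<Sum>i\<le>csize r. Poly_Mapping.single (low i r, high i r) 1) x"
  by (subst vlinear_eq_lin_ext[OF vlinear_comult]) (simp only: comult_single)

section \<open>Shifted shuffles and masks\<close>

definition shuf :: "'c cperm \<Rightarrow> 'c cperm \<Rightarrow> 'c cperm set" where
  "shuf p q = {r. csize r = csize p + csize q \<and> low (csize p) r = p \<and> high (csize p) r = q}"

text \<open>Described by letter counts because these are additive under concatenation, so cutting
  and joining masks needs no separate bookkeeping of lengths.\<close>

definition masks :: "nat \<Rightarrow> nat \<Rightarrow> bool list set" where
  "masks a b = {m. count_list m True = a \<and> count_list m False = b}"

lemma length_count_list_bool: "length m = count_list m True + count_list m False"
  by (induction m) auto

lemma length_mask: "m \<in> masks a b \<Longrightarrow> length m = a + b"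
  by (simp add: masks_def length_count_list_bool[of m])

lemma finite_masks [simp]: "finite (masks a b)"
  by (rule finite_subset[OF _ finite_lists_length_eq[of "UNIV :: bool set" "a + b"]])
    (auto simp: length_mask)

lemma Nil_in_masks_iff [simp]: "[] \<in> masks a b \<longleftrightarrow> a = 0 \<and> b = 0"
  by (auto simp: masks_def)

lemma Cons_in_masks_iff [simp]:
  "True # m \<in> masks a b \<longleftrightarrow> a > 0 \<and> m \<in> masks (a - 1) b"
  "False # m \<in> masks a b \<longleftrightarrow> b > 0 \<and> m \<in> masks a (b - 1)"
  by (auto simp: masks_def)

text \<open>The last equation also truncates when the mask does not fit the two words;
  \<open>mask_induct\<close> rules this case out for the masks that occur.\<close>

fun mask_merge :: "bool list \<Rightarrow> 'a list \<Rightarrow> 'a list \<Rightarrow> 'a list" where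
  "mask_merge (True # m) (a # v) w = a # mask_merge m v w"
| "mask_merge (False # m) v (b # w) = b # mask_merge m v w"
| "mask_merge _ _ _ = []"

lemma mask_induct [consumes 1, case_names Nil True False]:
  assumes "m \<in> masks (length v) (length w)" "P [] [] []"
    "\<And>m a v w. m \<in> masks (length v) (length w) \<Longrightarrow> P m v w \<Longrightarrow> P (True # m) (a # v) w"
    "\<And>m b v w. m \<in> masks (length v) (length w) \<Longrightarrow> P m v w \<Longrightarrow> P (False # m) v (b # w)"
  shows "P m v w"
  using assms(1)
proof (induction m arbitrary: v w)
  case Nil
  then show ?case using assms(2) by simp
next
  case (Cons x m)
  show ?case
  proof (cases x)
    case True
    then obtain a v' where "v = a # v'" "m \<in> masks (length v') (length w)"
      using Cons.prems by (cases v) auto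
    then show ?thesis using assms(3) Cons.IH True by simp
  next
    case False
    then obtain b w' where "w = b # w'" "m \<in> masks (length v) (length w')"
      using Cons.prems by (cases w) auto
    then show ?thesis using assms(4) Cons.IH False by simp
  qed
qed

lemma length_mask_merge: "m \<in> masks (length v) (length w) \<Longrightarrow> length (mask_merge m v w) = length v + length w"
  by (induction m v w rule: mask_induct) auto

lemma set_mask_merge_subset: "set (mask_merge m v w) \<subseteq> set v \<union> set w"
  by (induction m v w rule: mask_merge.induct) auto

lemma map_mask_merge: "map f (mask_merge m v w) = mask_merge m (map f v) (map f w)"
  by (induction m v w rule: mask_merge.induct) auto

lemma filter_mask_merge:
  assumes "m \<in> masks (length v) (length w)" "\<forall>x\<in>set v. P x" "\<forall>x\<in>set w. \<not> P x"
  shows "filter P (mask_merge m v w) = v" "filter (\<lambda>x. \<not> P x) (mask_merge m v w) = w"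
    "map P (mask_merge m v w) = m"
  using assms by (induction m v w rule: mask_induct) auto

lemma mask_merge_filter: "mask_merge (map P x) (filter P x) (filter (\<lambda>x. \<not> P x) x) = x"
  by (induction x) auto

lemma map_in_masks: "map P x \<in> masks (length (filter P x)) (length (filter (\<lambda>x. \<not> P x) x))"
  by (induction x) (auto simp: masks_def)

lemma mask_merge_append:
  assumes "m \<in> masks (length v) (length w)"
  shows "mask_merge (m @ m') (v @ v') (w @ w') = mask_merge m v w @ mask_merge m' v' w'"
  using assms by (induction m v w rule: mask_induct) auto

lemma append_in_masks: "m \<in> masks a b \<Longrightarrow> m' \<in> masks c d \<Longrightarrow> m @ m' \<in> masks (a + c) (b + d)"
  by (simp add: masks_def)

lemma sorted_wrt_mask_merge:
  assumes "sorted_wrt R v" "sorted_wrt R w" "\<And>x y. x \<in> set v \<Longrightarrow> y \<in> set w \<Longrightarrow> R x y \<and> R y x"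
  shows "sorted_wrt R (mask_merge m v w)"
  using assms
proof (induction m v w rule: mask_merge.induct)
  case (1 m a v w)
  then show ?case using set_mask_merge_subset[of m v w] by fastforce
next
  case (2 m v b w)
  then show ?case using set_mask_merge_subset[of m v w] by fastforce
qed auto

text \<open>Comparisons between a letter of the first word and one of the second have a forced
  outcome on both sides, so merging the two lists of triples gives a list of triples for the merged
  words.\<close>

lemma same_order_mask_merge:
  assumes "same_order v v'" "same_order w w'"
    "\<And>x y. x \<in> set v \<Longrightarrow> y \<in> set w \<Longrightarrow> fst x < fst y"
    "\<And>x y. x \<in> set v' \<Longrightarrow> y \<in> set w' \<Longrightarrow> fst x < fst y"
  shows "same_order (mask_merge m v w) (mask_merge m v' w')"
proof -
  obtain z where z: "v = map (\<lambda>(a, b, c). (a, c)) z" "v' = map (\<lambda>(a, b, c). (b, c)) z"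
    "sorted_wrt (\<lambda>(a, b, _) (a', b', _). a \<le> a' \<longleftrightarrow> b \<le> b') z"
    using assms(1) by (rule same_orderE)
  obtain y where y: "w = map (\<lambda>(a, b, c). (a, c)) y" "w' = map (\<lambda>(a, b, c). (b, c)) y"
    "sorted_wrt (\<lambda>(a, b, _) (a', b', _). a \<le> a' \<longleftrightarrow> b \<le> b') y"
    using assms(2) by (rule same_orderE)
  have "sorted_wrt (\<lambda>(a, b, _) (a', b', _). a \<le> a' \<longleftrightarrow> b \<le> b') (mask_merge m z y)"
  proof (intro sorted_wrt_mask_merge z(3) y(3))
    fix s t assume st: "s \<in> set z" "t \<in> set y"
    obtain a b c a' b' c' where abc: "s = (a, b, c)" "t = (a', b', c')"
      by (cases s, cases t)
    have "(a, c) \<in> set v" "(b, c) \<in> set v'" "(a', c') \<in> set w" "(b', c') \<in> set w'"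
      using st unfolding abc z(1,2) y(1,2) set_map by (force intro!: image_eqI)+
    then have "a < a'" "b < b'"
      using assms(3)[of "(a, c)" "(a', c')"] assms(4)[of "(b, c)" "(b', c')"] by simp_all
    then show "(case s of (a, b, _) \<Rightarrow> \<lambda>(a', b', _). a \<le> a' \<longleftrightarrow> b \<le> b') t \<and>
        (case t of (a, b, _) \<Rightarrow> \<lambda>(a', b', _). a \<le> a' \<longleftrightarrow> b \<le> b') s"
      by (simp add: abc)
  qed
  from same_orderI[OF this] show ?thesis
    unfolding map_mask_merge z(1,2) y(1,2) .
qed

text \<open>The inverse map marks the letters of \<open>r\<close> that belong to the first factor.
  The words \<open>v\<close> and \<open>w\<close> need not be standardized, only separated by
  \<open>t\<close>; this allows the same threshold to be kept for prefixes and suffixes of a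
  separated pair.\<close>

lemma shuf_bij_betw:
  assumes "\<forall>x\<in>set v. fst x \<le> t" "\<forall>x\<in>set w. t < fst x"
  shows "bij_betw (\<lambda>m. cstd (mask_merge m v w)) (masks (length v) (length w)) (shuf (cstd v) (cstd w))"
proof (rule bij_betwI[where g = "\<lambda>r. map (\<lambda>x. fst x \<le> length v) (cword r)"])
  have P: "\<forall>x\<in>set v. fst x \<le> t" "\<forall>x\<in>set w. \<not> fst x \<le> t"
    using assms by (auto simp: not_le)
  note filter = filter_mask_merge[OF _ P]
  show "(\<lambda>m. cstd (mask_merge m v w)) \<in> masks (length v) (length w) \<rightarrow> shuf (cstd v) (cstd w)"
    by (auto simp: shuf_def length_mask_merge low_cstd[of t] high_cstd[of t] filter)
  show "map (\<lambda>x. fst x \<le> length v) (cword (cstd (mask_merge m v w))) = m"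
    if m: "m \<in> masks (length v) (length w)" for m
  proof -
    \<comment> \<open>Exactly the letters of \<open>v\<close> are at most \<open>t\<close>, so
      standardization moves the threshold from \<open>t\<close> to \<open>length v\<close>.\<close>
    have "map (\<lambda>x. fst x \<le> length v) (cword (cstd (mask_merge m v w))) = map (\<lambda>x. fst x \<le> t) (mask_merge m v w)"
      using m by (intro nth_equalityI) (simp_all add: cword_cstd_threshold[of _ _ t] filter(1))
    then show ?thesis
      using m by (simp add: filter)
  qed
  show "(\<lambda>r. map (\<lambda>x. fst x \<le> length v) (cword r)) \<in> shuf (cstd v) (cstd w) \<rightarrow> masks (length v) (length w)"
  proof
    fix r assume "r \<in> shuf (cstd v) (cstd w)"
    then have "csize (low (length v) r) = length v" "csize (high (length v) r) = length w"
      by (simp_all add: shuf_def)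
    then show "map (\<lambda>x. fst x \<le> length v) (cword r) \<in> masks (length v) (length w)"
      using map_in_masks[of "\<lambda>x. fst x \<le> length v" "cword r"] by (simp add: low_def high_def)
  qed
  show "cstd (mask_merge (map (\<lambda>x. fst x \<le> length v) (cword r)) v w) = r"
    if r: "r \<in> shuf (cstd v) (cstd w)" for r
  proof -
    let ?P = "\<lambda>x. fst x \<le> length v"
    have "same_order v (filter ?P (cword r))" "same_order w (filter (\<lambda>x. \<not> ?P x) (cword r))"
      using r by (simp_all add: shuf_def low_def high_def cstd_eq_iff[symmetric])
    then have "same_order (mask_merge (map ?P (cword r)) v w)
        (mask_merge (map ?P (cword r)) (filter ?P (cword r)) (filter (\<lambda>x. \<not> ?P x) (cword r)))"
      using assms by (intro same_order_mask_merge) force+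
    then show ?thesis
      unfolding mask_merge_filter cstd_eq_iff[symmetric] by simp
  qed
qed

lemma sum_shuf:
  assumes "\<forall>x\<in>set v. fst x \<le> t" "\<forall>x\<in>set w. t < fst x"
  shows "sum f (shuf (cstd v) (cstd w)) = (\<Sum>m\<in>masks (length v) (length w). f (cstd (mask_merge m v w)))"
  using sum.reindex_bij_betw[OF shuf_bij_betw[OF assms], where g = f] by simp

text \<open>Raises the letters of the second factor above those of the first without changing its
  class, which yields a separated pair of representatives.\<close>

definition shift :: "nat \<Rightarrow> (nat \<times> 'c) list \<Rightarrow> (nat \<times> 'c) list" where
  "shift k w = map (\<lambda>(a, c). (a + k, c)) w"

lemma cstd_shift: "cstd (shift k w) = cstd w"
proof -
  have "same_order (map (\<lambda>(a, b, c). (a, c)) (map (\<lambda>(a, c). (a + k, a, c)) w))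
      (map (\<lambda>(a, b, c). (b, c)) (map (\<lambda>(a, c). (a + k, a, c)) w))"
    by (rule same_orderI) (auto simp: sorted_wrt_iff_nth_less case_prod_unfold)
  then show ?thesis
    by (simp add: cstd_eq_iff shift_def comp_def case_prod_unfold)
qed

lemma shift_bounds:
  "x \<in> set (cword p) \<Longrightarrow> fst x \<le> csize p"
  "x \<in> set (shift k (cword p)) \<Longrightarrow> k < fst x"
  using cword_fst_bounds by (fastforce simp: shift_def)+

lemma finite_shuf: "finite (shuf p q)"
  using bij_betw_finite[OF shuf_bij_betw[of "cword p" "csize p" "shift (csize p) (cword q)"]]
  by (simp add: cstd_shift shift_bounds)

lemma lookup_comult:
  "Poly_Mapping.lookup (\<Delta> x) (p, q) = (\<Sum>r\<in>shuf p q. Poly_Mapping.lookup x r)"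
  unfolding comult_eq
proof (rule lookup_lin_ext[OF finite_shuf])
  fix r
  have "Poly_Mapping.lookup (\<Sum>i\<le>csize r. Poly_Mapping.single (low i r, high i r) 1) (p, q) =
      (\<Sum>i\<le>csize r. if i = csize p then of_bool (r \<in> shuf p q) else 0)"
    unfolding lookup_sum
  proof (intro sum.cong refl)
    fix i assume i: "i \<in> {..csize r}"
    \<comment> \<open>The size of \<open>low i r\<close> is \<open>i\<close>, so \<open>p\<close>
      determines the only cut that can contribute.\<close>
    then have "low i r = p \<and> high i r = q \<longleftrightarrow> i = csize p \<and> r \<in> shuf p q"
      by (auto simp: shuf_def csize_low csize_high)
    then show "Poly_Mapping.lookup (Poly_Mapping.single (low i r, high i r) 1) (p, q) =
        (if i = csize p then of_bool (r \<in> shuf p q) else 0)"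
      by (auto simp: lookup_single when_def)
  qed
  also have "\<dots> = of_bool (r \<in> shuf p q)"
    by (auto simp: shuf_def)
  also have "\<dots> = (\<Sum>k\<in>shuf p q. of_bool (k = r))"
    by (simp add: of_bool_def finite_shuf)
  finally show "Poly_Mapping.lookup (\<Sum>i\<le>csize r. Poly_Mapping.single (low i r, high i r) 1) (p, q) =
      (\<Sum>k\<in>shuf p q. of_bool (k = r))" .
qed

section \<open>The coproduct is multiplicative\<close>

text \<open>The product of the tensor square, acting on both components separately; in coefficients
  it is a pair of independent cuts.\<close>

definition tmult :: "('c cperm \<times> 'c cperm) vec \<Rightarrow> ('c cperm \<times> 'c cperm) vec \<Rightarrow> ('c cperm \<times> 'c cperm) vec" where
  "tmult = bilin_ext (\<lambda>(a, b) (c, d).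
     (Poly_Mapping.single a 1 \<odot> Poly_Mapping.single c 1) \<otimes> (Poly_Mapping.single b 1 \<odot> Poly_Mapping.single d 1))"

lemma lookup_tmult:
  "Poly_Mapping.lookup (tmult X Y) (p, q) = (\<Sum>i\<le>csize p. \<Sum>j\<le>csize q.
     Poly_Mapping.lookup X (ctake i p, ctake j q) * Poly_Mapping.lookup Y (cdrop i p, cdrop j q))"
proof -
  have "Poly_Mapping.lookup (tmult X Y) (p, q) = (\<Sum>k\<in>{..csize p} \<times> {..csize q}.
      Poly_Mapping.lookup X (ctake (fst k) p, ctake (snd k) q) *
      Poly_Mapping.lookup Y (cdrop (fst k) p, cdrop (snd k) q))"
    unfolding tmult_def
  proof (rule lookup_bilin_ext)
    fix ab cd :: "'a cperm \<times> 'a cperm"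
    obtain a b c d where abcd: "ab = (a, b)" "cd = (c, d)"
      by (cases ab, cases cd)
    show "Poly_Mapping.lookup ((case ab of (a, b) \<Rightarrow> \<lambda>(c, d).
        (Poly_Mapping.single a 1 \<odot> Poly_Mapping.single c 1) \<otimes> (Poly_Mapping.single b 1 \<odot> Poly_Mapping.single d 1)) cd) (p, q) =
      (\<Sum>k\<in>{..csize p} \<times> {..csize q}. of_bool ((ctake (fst k) p, ctake (snd k) q) = ab \<and>
         (cdrop (fst k) p, cdrop (snd k) q) = cd))"
      unfolding abcd prod.case lookup_tensor lookup_mult sum_product sum.cartesian_product
      by (intro sum.cong) (auto simp: lookup_single when_def)
  qed simp
  then show ?thesis
    by (simp add: sum.cartesian_product case_prod_unfold)
qed

lemma tmult_simps:
  "tmult (X + X') Y = tmult X Y + tmult X' Y" "tmult X (Y + Y') = tmult X Y + tmult X Y'"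
  "tmult (vscale c X) Y = vscale c (tmult X Y)" "tmult X (vscale c Y) = vscale c (tmult X Y)"
  "tmult 0 Y = 0" "tmult X 0 = 0"
  by (auto intro!: poly_mapping_eqI simp: lookup_tmult lookup_vscale Poly_Mapping.lookup_add
      ring_distribs sum.distrib sum_distrib_left mult_ac)

lemma tmult_tensor: "tmult (a \<otimes> b) (c \<otimes> d) = (a \<odot> c) \<otimes> (b \<odot> d)"
  by (auto intro!: poly_mapping_eqI simp: lookup_tmult lookup_tensor lookup_mult sum_product mult_ac)

lemma twist_tmult: "twist (tmult X Y) = tmult (twist X) (twist Y)"
  by (rule poly_mapping_eqI, clarify) (simp only: lookup_twist lookup_tmult, rule sum.swap)

text \<open>A mask with a cut is the same as a pair of masks with complementary contents. The
  content \<open>(i, j)\<close> of the left piece replaces the position of the cut, which is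
  \<open>i + j\<close>.\<close>

lemma sum_masks_split:
  fixes f :: "bool list \<Rightarrow> bool list \<Rightarrow> 'b::comm_monoid_add"
  shows "(\<Sum>m\<in>masks a b. \<Sum>k\<le>a + b. f (take k m) (drop k m)) =
    (\<Sum>i\<le>a. \<Sum>j\<le>b. \<Sum>m1\<in>masks i j. \<Sum>m2\<in>masks (a - i) (b - j). f m1 m2)"
proof -
  have "(\<Sum>m\<in>masks a b. \<Sum>k\<le>a + b. f (take k m) (drop k m)) =
     (\<Sum>(m, k)\<in>masks a b \<times> {..a + b}. f (take k m) (drop k m))"
    by (rule sum.cartesian_product)
  also have "\<dots> = (\<Sum>((i, j), (m1, m2))\<in>(SIGMA (i, j) : {..a} \<times> {..b}. masks i j \<times> masks (a - i) (b - j)). f m1 m2)"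
  proof (rule sum.reindex_bij_witness[of _ "\<lambda>((i, j), (m1, m2)). (m1 @ m2, length m1)"
      "\<lambda>(m, k). ((count_list (take k m) True, count_list (take k m) False), (take k m, drop k m))"], goal_cases)
    case (1 mk)
    then show ?case
      by (auto simp: length_mask)
  next
    case (2 mk)
    then obtain m k where mk: "mk = (m, k)" "m \<in> masks a b" "k \<le> a + b"
      by auto
    have "count_list m x = count_list (take k m) x + count_list (drop k m) x" for x
      by (metis append_take_drop_id count_list_append)
    then show ?case
      using mk by (auto simp: masks_def)
  qed (auto simp: length_mask append_in_masks masks_def length_count_list_bool)
  also have "\<dots> = (\<Sum>(i, j)\<in>{..a} \<times> {..b}. \<Sum>(m1, m2)\<in>masks i j \<times> masks (a - i) (b - j). f m1 m2)"
    using sum.Sigma[of "{..a} \<times> {..b}" "\<lambda>(i, j). masks i j \<times> masks (a - i) (b - j)" "\<lambda>_ (m1, m2). f m1 m2"]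
    by (simp add: case_prod_unfold)
  also have "\<dots> = (\<Sum>i\<le>a. \<Sum>j\<le>b. \<Sum>m1\<in>masks i j. \<Sum>m2\<in>masks (a - i) (b - j). f m1 m2)"
    by (simp add: sum.cartesian_product)
  finally show ?thesis .
qed

text \<open>On the left one shuffles \<open>p\<close> with \<open>q\<close> and then cuts the
  result; on the right one cuts \<open>p\<close> and \<open>q\<close> and then shuffles left pieces
  with left pieces and right with right.\<close>

lemma comult_mult: "\<Delta> (x \<odot> y) = tmult (\<Delta> x) (\<Delta> y)"
proof (rule poly_mapping_eqI, clarify)
  fix p q :: "'a cperm"
  define v where "v = cword p"
  define w where "w = shift (csize p) (cword q)"
  define t where "t = csize p"
  have bounds: "\<forall>x\<in>set v. fst x \<le> t" "\<forall>x\<in>set w. t < fst x"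
    by (simp_all add: v_def w_def t_def shift_bounds)
  have p: "p = cstd v" and q: "q = cstd w"
    by (simp_all add: v_def w_def cstd_shift)
  have len: "csize p = length v" "csize q = length w"
    by (simp_all add: p q)
  \<comment> \<open>The left mask alone tells how many letters of \<open>v\<close> and of
    \<open>w\<close> lie before the cut, so the summand is a function of the two pieces of the
    mask.\<close>
  let ?f = "\<lambda>m1 m2. Poly_Mapping.lookup x (cstd (mask_merge m1 (take (count_list m1 True) v) (take (count_list m1 False) w))) *
     Poly_Mapping.lookup y (cstd (mask_merge m2 (drop (count_list m1 True) v) (drop (count_list m1 False) w)))"
  have split: "take k (mask_merge m v w) = mask_merge (take k m) (take (count_list (take k m) True) v) (take (count_list (take k m) False) w)"
    "drop k (mask_merge m v w) = mask_merge (drop k m) (drop (count_list (take k m) True) v) (drop (count_list (take k m) False) w)"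
    if "m \<in> masks (length v) (length w)" "k \<le> length v + length w" for m k
  proof -
    let ?i = "count_list (take k m) True" and ?j = "count_list (take k m) False"
    have "count_list m x = count_list (take k m) x + count_list (drop k m) x" for x
      by (metis append_take_drop_id count_list_append)
    then have *: "?i \<le> length v" "?j \<le> length w"
      using that by (auto simp: masks_def)
    have "take k m \<in> masks (length (take ?i v)) (length (take ?j w))"
      using * by (simp add: masks_def)
    then have "mask_merge (take k m @ drop k m) (take ?i v @ drop ?i v) (take ?j w @ drop ?j w) =
       mask_merge (take k m) (take ?i v) (take ?j w) @ mask_merge (drop k m) (drop ?i v) (drop ?j w)"
      and "length (mask_merge (take k m) (take ?i v) (take ?j w)) = k"
      using * that length_mask[OF that(1)] length_count_list_bool[of "take k m"]
      by (simp_all only: mask_merge_append length_mask_merge) simp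
    then show "take k (mask_merge m v w) = mask_merge (take k m) (take ?i v) (take ?j w)"
      "drop k (mask_merge m v w) = mask_merge (drop k m) (drop ?i v) (drop ?j w)"
      by simp_all
  qed
  have "Poly_Mapping.lookup (\<Delta> (x \<odot> y)) (p, q) = (\<Sum>m\<in>masks (length v) (length w). \<Sum>k\<le>length v + length w.
      Poly_Mapping.lookup x (cstd (take k (mask_merge m v w))) * Poly_Mapping.lookup y (cstd (drop k (mask_merge m v w))))"
    unfolding lookup_comult lookup_mult p q sum_shuf[OF bounds]
    by (intro sum.cong) (simp_all add: ctake_cstd cdrop_cstd length_mask_merge)
  also have "\<dots> = (\<Sum>m\<in>masks (length v) (length w). \<Sum>k\<le>length v + length w. ?f (take k m) (drop k m))"
    by (intro sum.cong) (simp_all add: split)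
  also have "\<dots> = (\<Sum>i\<le>length v. \<Sum>j\<le>length w. \<Sum>m1\<in>masks i j. \<Sum>m2\<in>masks (length v - i) (length w - j). ?f m1 m2)"
    by (rule sum_masks_split)
  also have "\<dots> = (\<Sum>i\<le>csize p. \<Sum>j\<le>csize q.
     Poly_Mapping.lookup (\<Delta> x) (ctake i p, ctake j q) * Poly_Mapping.lookup (\<Delta> y) (cdrop i p, cdrop j q))"
    unfolding len
  proof (intro sum.cong refl)
    fix i j assume ij: "i \<in> {..length v}" "j \<in> {..length w}"
    \<comment> \<open>The pieces of \<open>v\<close> and \<open>w\<close> are in general not
      standardized, but \<open>t\<close> still separates them, so \<open>sum_shuf\<close> applies
      directly.\<close>
    have 1: "Poly_Mapping.lookup (\<Delta> x) (ctake i p, ctake j q) =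
       (\<Sum>m\<in>masks i j. Poly_Mapping.lookup x (cstd (mask_merge m (take i v) (take j w))))"
      unfolding lookup_comult p q ctake_cstd using ij bounds
      by (subst sum_shuf[of _ t]) (auto dest: in_set_takeD simp: min_def)
    have 2: "Poly_Mapping.lookup (\<Delta> y) (cdrop i p, cdrop j q) =
       (\<Sum>m\<in>masks (length v - i) (length w - j). Poly_Mapping.lookup y (cstd (mask_merge m (drop i v) (drop j w))))"
      unfolding lookup_comult p q cdrop_cstd using ij bounds
      by (subst sum_shuf[of _ t]) (auto dest: in_set_dropD)
    show "(\<Sum>m1\<in>masks i j. \<Sum>m2\<in>masks (length v - i) (length w - j). ?f m1 m2) =
      Poly_Mapping.lookup (\<Delta> x) (ctake i p, ctake j q) * Poly_Mapping.lookup (\<Delta> y) (cdrop i p, cdrop j q)"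
      unfolding 1 2 sum_product by (intro sum.cong) (auto simp: masks_def)
  qed
  finally show "Poly_Mapping.lookup (\<Delta> (x \<odot> y)) (p, q) = Poly_Mapping.lookup (tmult (\<Delta> x) (\<Delta> y)) (p, q)"
    unfolding lookup_tmult .
qed

section \<open>Antipode\<close>

lemma conv_prod_single:
  "conv_prod f g (Poly_Mapping.single r 1) =
     (\<Sum>i\<le>csize r. f (Poly_Mapping.single (low i r) 1) \<odot> g (Poly_Mapping.single (high i r) 1))"
  by (simp add: conv_prod_def comult_single vlinear_sum[OF vlinear_lin_ext] lin_ext_single)

lemma vlinear_conv_prod: "vlinear (conv_prod f g)"
  by (rule vlinearI)
    (simp_all add: conv_prod_def vlinear_add[OF vlinear_lin_ext] vlinear_add[OF vlinear_comult]
      vlinear_scale[OF vlinear_lin_ext] vlinear_scale[OF vlinear_comult])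

text \<open>Convolution is defined through basis elements, which usually lie outside a given
  subalgebra. This evaluates it on arbitrary pure tensors and so lets it be restricted to
  subalgebras.\<close>

lemma lin_ext_mult_tensor:
  assumes f: "vlinear f" and g: "vlinear g"
  shows "lin_ext (\<lambda>(p, q). f (Poly_Mapping.single p 1) \<odot> g (Poly_Mapping.single q 1)) (x \<otimes> y) = f x \<odot> g y"
proof (rule vlinear_eqI[of "\<lambda>x. lin_ext _ (x \<otimes> y)" "\<lambda>x. f x \<odot> g y"])
  fix p
  show "lin_ext (\<lambda>(p, q). f (Poly_Mapping.single p 1) \<odot> g (Poly_Mapping.single q 1)) (Poly_Mapping.single p 1 \<otimes> y) =
      f (Poly_Mapping.single p 1) \<odot> g y"
    by (rule vlinear_eqI[of "\<lambda>y. lin_ext _ (_ \<otimes> y)" "\<lambda>y. _ \<odot> g y"])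
      (auto intro!: vlinearI simp: tensor_simps mult_simps vlinear_add[OF g] vlinear_scale[OF g]
        vlinear_add[OF vlinear_lin_ext] vlinear_scale[OF vlinear_lin_ext] tensor_single lin_ext_single)
qed (auto intro!: vlinearI simp: tensor_simps mult_simps vlinear_add[OF f] vlinear_scale[OF f]
       vlinear_add[OF vlinear_lin_ext] vlinear_scale[OF vlinear_lin_ext])

text \<open>On a basis element both sides sum over pairs of cuts by value, and the three pieces
  agree by \<open>low_low\<close>, \<open>high_low\<close> and \<open>high_high\<close>.\<close>

lemma conv_prod_assoc: "conv_prod (conv_prod f g) h = conv_prod f (conv_prod g h)"
proof
  fix x
  show "conv_prod (conv_prod f g) h x = conv_prod f (conv_prod g h) x"
  proof (rule vlinear_eqI[OF vlinear_conv_prod vlinear_conv_prod])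
    fix r :: "'a cperm"
    let ?s = "\<lambda>p :: 'a cperm. Poly_Mapping.single p (1 :: complex)"
    have "conv_prod (conv_prod f g) h (?s r) =
        (\<Sum>i\<le>csize r. \<Sum>j\<le>i. f (?s (low j r)) \<odot> g (?s (high j (low i r))) \<odot> h (?s (high i r)))"
      by (auto simp: conv_prod_single csize_low mult_sum_left low_low intro!: sum.cong)
    also have "\<dots> = (\<Sum>j\<le>csize r. \<Sum>i\<le>csize r - j.
        f (?s (low j r)) \<odot> g (?s (high j (low (i + j) r))) \<odot> h (?s (high (i + j) r)))"
      by (rule sum_triangle)
    also have "\<dots> = conv_prod f (conv_prod g h) (?s r)"
      by (auto simp: conv_prod_single csize_high mult_sum_right mult_assoc high_low high_high add.commute
          intro!: sum.cong)
    finally show "conv_prod (conv_prod f g) h (?s r) = conv_prod f (conv_prod g h) (?s r)" .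
  qed
qed

section \<open>The unit of the convolution product\<close>

definition unit_counit :: "'c fqsym \<Rightarrow> 'c fqsym" where
  "unit_counit x = vscale (fq_counit x) fq_one"

lemma fq_counit_eq: "fq_counit x = Poly_Mapping.lookup x (cstd [])"
  by (simp add: fq_counit_def cstd_def std_def)

lemma vlinear_unit_counit: "vlinear unit_counit"
  by (rule vlinearI) (simp_all add: unit_counit_def fq_counit_eq Poly_Mapping.lookup_add lookup_vscale vec.scale_left_distrib)

lemma unit_counit_single:
  "unit_counit (Poly_Mapping.single p 1) = (if csize p = 0 then fq_one else 0)"
  by (simp add: unit_counit_def fq_counit_eq lookup_single csize_eq_0_iff when_def del: length_0_conv)

lemma single_cstd_Nil: "csize p = 0 \<Longrightarrow> Poly_Mapping.single p 1 = fq_one"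
  by (simp add: csize_eq_0_iff fq_one_eq del: length_0_conv)

lemma high_0: "high 0 r = r"
proof -
  have "filter (\<lambda>x. \<not> fst x \<le> 0) (cword r) = cword r"
    using cword_fst_bounds[of _ r] by (force intro: filter_True)
  then show ?thesis
    by (simp only: high_def cstd_cword)
qed

lemma low_csize: "low (csize r) r = r"
proof -
  have "filter (\<lambda>x. fst x \<le> csize r) (cword r) = cword r"
    using cword_fst_bounds[of _ r] by (force intro: filter_True)
  then show ?thesis
    by (simp only: low_def cstd_cword)
qed

lemma conv_prod_unit_left:
  assumes "vlinear f"
  shows "conv_prod unit_counit f = f"
proof
  fix x
  show "conv_prod unit_counit f x = f x"
  proof (rule vlinear_eqI[OF vlinear_conv_prod assms])
    fix r
    have "conv_prod unit_counit f (Poly_Mapping.single r 1) =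
        (\<Sum>i\<le>csize r. if i = 0 then f (Poly_Mapping.single (high i r) 1) else 0)"
      unfolding conv_prod_single
      by (intro sum.cong) (auto simp: unit_counit_single csize_low mult_simps)
    then show "conv_prod unit_counit f (Poly_Mapping.single r 1) = f (Poly_Mapping.single r 1)"
      by (simp add: high_0)
  qed
qed

lemma conv_prod_unit_right:
  assumes "vlinear f"
  shows "conv_prod f unit_counit = f"
proof
  fix x
  show "conv_prod f unit_counit x = f x"
  proof (rule vlinear_eqI[OF vlinear_conv_prod assms])
    fix r
    have "conv_prod f unit_counit (Poly_Mapping.single r 1) =
        (\<Sum>i\<le>csize r. if i = csize r then f (Poly_Mapping.single (low i r) 1) else 0)"
      unfolding conv_prod_single
      by (intro sum.cong) (auto simp: unit_counit_single csize_high mult_simps)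
    then show "conv_prod f unit_counit (Poly_Mapping.single r 1) = f (Poly_Mapping.single r 1)"
      by (simp add: low_csize)
  qed
qed

section \<open>The convolution inverse of the identity as a geometric series\<close>

definition reduced_id :: "'c fqsym \<Rightarrow> 'c fqsym" where
  "reduced_id x = x - unit_counit x"

primrec reduced_pow :: "nat \<Rightarrow> 'c fqsym \<Rightarrow> 'c fqsym" where
  "reduced_pow 0 = unit_counit"
| "reduced_pow (Suc k) = conv_prod reduced_id (reduced_pow k)"

lemma vlinear_reduced_id: "vlinear reduced_id"
  by (rule vlinearI)
    (simp_all add: reduced_id_def vlinear_add[OF vlinear_unit_counit] vlinear_scale[OF vlinear_unit_counit]
      vec.scale_right_diff_distrib)

lemma vlinear_reduced_pow: "vlinear (reduced_pow k)"
  by (cases k) (simp_all add: vlinear_unit_counit vlinear_conv_prod)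

text \<open>Powers are built by convolving on the left. The antipode identity with \<open>id\<close>
  on the right needs the extra factor on the right.\<close>

lemma reduced_pow_Suc': "conv_prod (reduced_pow k) reduced_id = reduced_pow (Suc k)"
  by (induction k)
    (simp_all add: conv_prod_unit_left conv_prod_unit_right vlinear_reduced_id conv_prod_assoc)

text \<open>\<open>reduced_id\<close> kills degree 0, so each of the \<open>k\<close> factors has to
  use up at least one letter of \<open>r\<close>.\<close>

lemma reduced_pow_nilpotent: "csize r < k \<Longrightarrow> reduced_pow k (Poly_Mapping.single r 1) = 0"
proof (induction k arbitrary: r)
  case (Suc k)
  have "reduced_id (Poly_Mapping.single (low i r) 1) \<odot> reduced_pow k (Poly_Mapping.single (high i r) 1) = 0"
    if "i \<le> csize r" for i
  proof (cases "i = 0")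
    case True
    then have "csize (low i r) = 0"
      by (simp add: csize_low)
    then have "reduced_id (Poly_Mapping.single (low i r) 1) = 0"
      by (simp add: reduced_id_def unit_counit_def fq_counit_eq lookup_one single_cstd_Nil)
    then show ?thesis
      by (simp add: mult_simps)
  next
    case False
    then have "csize (high i r) < k"
      using that Suc.prems by (simp add: csize_high)
    then show ?thesis
      by (simp add: Suc.IH mult_simps)
  qed
  then show ?case
    by (simp add: conv_prod_single)
qed simp

definition antipode :: "'c fqsym \<Rightarrow> 'c fqsym" where
  "antipode = lin_ext (\<lambda>p. \<Sum>k\<le>csize p. vscale ((- 1) ^ k) (reduced_pow k (Poly_Mapping.single p 1)))"

text \<open>On elements of bounded degree the antipode is one fixed linear combination of
  convolution powers. This uniform form allows the exchange of sums and the passage to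
  subalgebras.\<close>

lemma antipode_eq:
  assumes "\<And>p. p \<in> Poly_Mapping.keys x \<Longrightarrow> csize p \<le> N"
  shows "antipode x = (\<Sum>k\<le>N. vscale ((- 1) ^ k) (reduced_pow k x))"
proof -
  let ?s = "\<lambda>p. Poly_Mapping.single p 1"
  have "antipode x = (\<Sum>p\<in>Poly_Mapping.keys x. vscale (Poly_Mapping.lookup x p)
      (\<Sum>k\<le>N. vscale ((- 1) ^ k) (reduced_pow k (?s p))))"
    unfolding antipode_def lin_ext_def using assms
    by (intro sum.cong arg_cong[where f = "vscale _"] sum.mono_neutral_left)
      (auto simp: reduced_pow_nilpotent not_le)
  also have "\<dots> = (\<Sum>k\<le>N. \<Sum>p\<in>Poly_Mapping.keys x. vscale ((- 1) ^ k) (vscale (Poly_Mapping.lookup x p) (reduced_pow k (?s p))))"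
    unfolding vec.scale_sum_right by (subst sum.swap) (simp add: mult_ac)
  also have "\<dots> = (\<Sum>k\<le>N. vscale ((- 1) ^ k) (reduced_pow k x))"
    by (simp only: vec.scale_sum_right[symmetric] lin_ext_def[symmetric] vlinear_eq_lin_ext[OF vlinear_reduced_pow, symmetric])
  finally show ?thesis .
qed

text \<open>\<open>id\<close> is the sum of \<open>reduced_id\<close> and the convolution unit.
  Applied to powers, this yields the sum of two consecutive powers, so the alternating series
  telescopes.\<close>

lemma conv_prod_id_right: "vlinear f \<Longrightarrow> conv_prod f id x = conv_prod f reduced_id x + f x"
proof -
  assume f: "vlinear f"
  show ?thesis
  proof (rule vlinear_eqI[of _ "\<lambda>x. conv_prod f reduced_id x + f x"])
    fix r
    have "conv_prod f id (Poly_Mapping.single r 1) =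
        conv_prod f reduced_id (Poly_Mapping.single r 1) + conv_prod f unit_counit (Poly_Mapping.single r 1)"
      by (simp add: conv_prod_single reduced_id_def sum.distrib[symmetric] mult_simps[symmetric])
    then show "conv_prod f id (Poly_Mapping.single r 1) =
        conv_prod f reduced_id (Poly_Mapping.single r 1) + f (Poly_Mapping.single r 1)"
      by (simp add: conv_prod_unit_right f)
  qed (auto intro!: vlinearI vlinear_conv_prod simp: vlinear_add[OF vlinear_conv_prod] vlinear_add[OF f]
      vlinear_scale[OF vlinear_conv_prod] vlinear_scale[OF f] vec.scale_right_distrib)
qed

lemma conv_prod_id_left: "vlinear f \<Longrightarrow> conv_prod id f x = conv_prod reduced_id f x + f x"
proof -
  assume f: "vlinear f"
  show ?thesis
  proof (rule vlinear_eqI[of _ "\<lambda>x. conv_prod reduced_id f x + f x"])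
    fix r
    have "conv_prod id f (Poly_Mapping.single r 1) =
        conv_prod reduced_id f (Poly_Mapping.single r 1) + conv_prod unit_counit f (Poly_Mapping.single r 1)"
      by (simp add: conv_prod_single reduced_id_def sum.distrib[symmetric] mult_simps[symmetric])
    then show "conv_prod id f (Poly_Mapping.single r 1) =
        conv_prod reduced_id f (Poly_Mapping.single r 1) + f (Poly_Mapping.single r 1)"
      by (simp add: conv_prod_unit_left f)
  qed (auto intro!: vlinearI vlinear_conv_prod simp: vlinear_add[OF vlinear_conv_prod] vlinear_add[OF f]
      vlinear_scale[OF vlinear_conv_prod] vlinear_scale[OF f] vec.scale_right_distrib)
qed

lemma alternating_telescope:
  "(\<Sum>k\<le>n. vscale ((- 1) ^ k) (a (Suc k) + a k)) = a 0 + vscale ((- 1) ^ n) (a (Suc n))"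
  by (induction n) (simp_all add: vec.scale_right_distrib)

lemma is_antipode_antipode: "is_antipode (antipode :: 'c fqsym \<Rightarrow> 'c fqsym)"
proof -
  let ?s = "\<lambda>p. Poly_Mapping.single p 1"
  have lin: "vlinear (antipode :: 'c fqsym \<Rightarrow> 'c fqsym)"
    unfolding antipode_def by (rule vlinear_lin_ext)
  \<comment> \<open>What remains is the zeroth power and the power with exponent
    \<open>csize r + 1\<close>; the latter vanishes on \<open>r\<close> by nilpotency.\<close>
  have tele: "(\<Sum>k\<le>csize r. vscale ((- 1) ^ k) (reduced_pow (Suc k) (?s r) + reduced_pow k (?s r))) = unit_counit (?s r)" for r
    unfolding alternating_telescope[of "\<lambda>k. reduced_pow k (?s r)"] by (simp add: reduced_pow_nilpotent del: reduced_pow.simps(2))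
  have single: "antipode (?s p) = (\<Sum>k\<le>N. vscale ((- 1) ^ k) (reduced_pow k (?s p)))" if "csize p \<le> N" for p N
    using that by (intro antipode_eq) simp
  have left: "conv_prod antipode id (?s r) = unit_counit (?s r)" for r
  proof -
    \<comment> \<open>The bound \<open>csize r\<close> serves all pieces \<open>low i r\<close>, so
      the range of \<open>k\<close> does not depend on \<open>i\<close> and the sums can be
      exchanged.\<close>
    have "conv_prod antipode id (?s r) = (\<Sum>i\<le>csize r. \<Sum>k\<le>csize r.
        vscale ((- 1) ^ k) (reduced_pow k (?s (low i r)) \<odot> ?s (high i r)))"
      unfolding conv_prod_single
      by (intro sum.cong) (auto simp: single[of _ "csize r"] csize_low mult_sum_left mult_simps)
    also have "\<dots> = (\<Sum>k\<le>csize r. vscale ((- 1) ^ k) (conv_prod (reduced_pow k) id (?s r)))"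
      by (subst sum.swap) (simp add: conv_prod_single vec.scale_sum_right)
    also have "\<dots> = unit_counit (?s r)"
      unfolding conv_prod_id_right[OF vlinear_reduced_pow] reduced_pow_Suc' by (rule tele)
    finally show ?thesis .
  qed
  have right: "conv_prod id antipode (?s r) = unit_counit (?s r)" for r
  proof -
    have "conv_prod id antipode (?s r) = (\<Sum>i\<le>csize r. \<Sum>k\<le>csize r.
        vscale ((- 1) ^ k) (?s (low i r) \<odot> reduced_pow k (?s (high i r))))"
      unfolding conv_prod_single
      by (intro sum.cong) (auto simp: single[of _ "csize r"] csize_high mult_sum_right mult_simps)
    also have "\<dots> = (\<Sum>k\<le>csize r. vscale ((- 1) ^ k) (conv_prod id (reduced_pow k) (?s r)))"
      by (subst sum.swap) (simp add: conv_prod_single vec.scale_sum_right)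
    also have "\<dots> = unit_counit (?s r)"
      unfolding conv_prod_id_left[OF vlinear_reduced_pow] reduced_pow.simps(2)[symmetric] by (rule tele)
    finally show ?thesis .
  qed
  have "conv_prod antipode id x = unit_counit x" "conv_prod id antipode x = unit_counit x" for x :: "'c fqsym"
    by (rule vlinear_eqI[OF vlinear_conv_prod vlinear_unit_counit], rule left)
      (rule vlinear_eqI[OF vlinear_conv_prod vlinear_unit_counit], rule right)
  then show ?thesis
    using lin by (simp add: is_antipode_def unit_counit_def)
qed

section \<open>Hopf subalgebras\<close>

lemma subspace_tensor_space: "vec.subspace (tensor_space A B)"
  unfolding tensor_space_def by (rule vec.subspace_span)

lemma tensor_in_tensor_space: "x \<in> A \<Longrightarrow> y \<in> B \<Longrightarrow> x \<otimes> y \<in> tensor_space A B"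
  unfolding tensor_space_def by (rule vec.span_base) blast

lemma tensor_space_image_subset:
  assumes "vlinear f" "vec.subspace V" "\<And>x y. x \<in> A \<Longrightarrow> y \<in> B \<Longrightarrow> f (x \<otimes> y) \<in> V" "X \<in> tensor_space A B"
  shows "f X \<in> V"
  using assms(4) unfolding tensor_space_def
proof (induction rule: vec.span_induct_alt)
  case base
  then show ?case using assms(1,2) by (simp add: vlinear_0 vec.subspace_0)
next
  case (step c x y)
  then show ?case
    using assms(1-3) by (auto simp: vlinear_add vlinear_scale intro!: vec.subspace_add vec.subspace_scale)
qed

lemma tmult_in_tensor_space:
  assumes "subalgebra A" "X \<in> tensor_space A A" "Y \<in> tensor_space A A"
  shows "tmult X Y \<in> tensor_space A A"
proof (rule tensor_space_image_subset[OF _ subspace_tensor_space _ assms(2), of "\<lambda>X. tmult X Y"])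
  fix a b assume ab: "a \<in> A" "b \<in> A"
  show "tmult (a \<otimes> b) Y \<in> tensor_space A A"
    using ab assms(1)
    by (intro tensor_space_image_subset[OF _ subspace_tensor_space _ assms(3), of "tmult (a \<otimes> b)"])
      (auto intro!: vlinearI tensor_in_tensor_space simp: tmult_simps tmult_tensor subalgebra_def)
qed (auto intro!: vlinearI simp: tmult_simps)

lemma comult_one: "\<Delta> fq_one = fq_one \<otimes> fq_one"
  by (simp add: fq_one_eq comult_single low_csize[of "cstd []", simplified] high_0 tensor_single)

text \<open>Both conditions pass to products because \<Delta> is multiplicative and
  \<open>twist\<close> respects \<open>tmult\<close>. Collecting them in one subalgebra lets a
  single appeal to minimality of the hull extend both from generators.\<close>

lemma subalgebra_cocommutative_comult:
  assumes "subalgebra A"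
  shows "subalgebra {x. \<Delta> x \<in> tensor_space A A \<and> twist (\<Delta> x) = \<Delta> x}"
  unfolding subalgebra_def vec.subspace_def using assms
  by (auto simp: vlinear_0 vlinear_comult vlinear_twist vlinear_add vlinear_scale comult_mult comult_one
      twist_tensor twist_tmult subalgebra_def
      intro!: vec.subspace_0 vec.subspace_add vec.subspace_scale subspace_tensor_space
        tensor_in_tensor_space tmult_in_tensor_space)

lemma conv_prod_in_subalgebra:
  assumes "subalgebra A" "vlinear f" "vlinear g" "f ` A \<subseteq> A" "g ` A \<subseteq> A" "\<Delta> x \<in> tensor_space A A"
  shows "conv_prod f g x \<in> A"
  unfolding conv_prod_def
  using assms by (intro tensor_space_image_subset[OF vlinear_lin_ext _ _ assms(6)])
    (auto simp: lin_ext_mult_tensor subalgebra_def)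

lemma antipode_in_subalgebra:
  assumes A: "subalgebra A" and \<Delta>: "\<Delta> ` A \<subseteq> tensor_space A A"
  shows "antipode ` A \<subseteq> A"
proof -
  have sub: "vec.subspace A" and one: "fq_one \<in> A"
    using A by (simp_all add: subalgebra_def)
  have unit: "unit_counit ` A \<subseteq> A"
    using sub one by (auto simp: unit_counit_def intro: vec.subspace_scale)
  then have red: "reduced_id ` A \<subseteq> A"
    using sub by (auto simp: reduced_id_def intro!: vec.subspace_diff)
  have pow: "reduced_pow k ` A \<subseteq> A" for k
  proof (induction k)
    case (Suc k)
    then show ?case
      using \<Delta> by (auto intro!: conv_prod_in_subalgebra A vlinear_reduced_id vlinear_reduced_pow red)
  qed (simp add: unit)
  show ?thesis
  proof
    fix y assume "y \<in> antipode ` A"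
    then obtain x where x: "x \<in> A" "y = antipode x"
      by auto
    \<comment> \<open>Finite support gives a common degree bound, hence a finite combination of
      powers, each of which preserves \<open>A\<close>.\<close>
    have "csize p \<le> Max (csize ` Poly_Mapping.keys x)" if "p \<in> Poly_Mapping.keys x" for p
      using that by simp
    from antipode_eq[OF this] show "y \<in> A"
      using x pow by (auto intro!: vec.subspace_sum[OF sub] vec.subspace_scale[OF sub])
  qed
qed

lemma subalgebra_hull: "subalgebra (subalgebra hull X)"
  by (rule hull_in) (auto simp: subalgebra_def intro!: vec.subspace_Inter)

section \<open>Complete homogeneous functions\<close>

text \<open>The constant word represents the identity permutation because equal letters are numbered
  from left to right; its class consists of the weakly increasing words.\<close>

definition id_cperm :: "'c list \<Rightarrow> 'c cperm" where
  "id_cperm u = cstd (map (Pair 0) u)"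

definition words_of_content :: "('c \<Rightarrow> nat) \<Rightarrow> 'c list set" where
  "words_of_content n = {u. count_list u = n}"

lemma cstd_eq_id_cperm_iff: "cstd w = id_cperm u \<longleftrightarrow> sorted (map fst w) \<and> map snd w = u"
proof -
  have "cstd w = id_cperm u \<longleftrightarrow> std (map fst w) = std (map (\<lambda>_. 0) u) \<and> map snd w = u"
    unfolding id_cperm_def by (subst Rep_cperm_inject[symmetric]) (simp add: Rep_cstd comp_def)
  also have "\<dots> \<longleftrightarrow> sorted (map fst w) \<and> map snd w = u"
    by (auto simp: std_eq_iff sorted_iff_nth_mono_less)
  finally show ?thesis .
qed

lemma G_upt_eq: "length u = n \<Longrightarrow> G [1..<n + 1] u = Poly_Mapping.single (id_cperm u) 1"
  by (subst G_eq_cstd)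
    (auto simp: cstd_eq_id_cperm_iff permutations_of_set_def atLeastLessThanSuc_atLeastAtMost simp del: upt_Suc
      intro!: arg_cong[where f = "\<lambda>p. Poly_Mapping.single p 1"])

lemma weight_count_list: "weight (count_list u) = length u"
  by (simp add: weight_def sum_count_set)

lemma complete_S_eq: "complete_S n = (\<Sum>u\<in>words_of_content n. Poly_Mapping.single (id_cperm u) 1)"
proof -
  have "{u. length u = weight n \<and> (\<forall>c. count_list u c = n c)} = words_of_content n"
    by (auto simp: words_of_content_def weight_count_list)
  moreover have "length u = weight n" if "u \<in> words_of_content n" for u
    using that by (auto simp: words_of_content_def weight_count_list)
  ultimately show ?thesis
    unfolding complete_S_def by (simp only:) (intro sum.cong refl G_upt_eq, simp)
qed

lemma finite_words_of_content [simp]: "finite (words_of_content (n :: 'c::finite \<Rightarrow> nat))"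
  by (rule finite_subset[OF _ finite_lists_length_eq[of "UNIV :: 'c set" "weight n"]])
    (auto simp: words_of_content_def weight_count_list)

lemma words_of_content_nonempty: "\<exists>u. count_list u = (n :: 'c::finite \<Rightarrow> nat)"
proof -
  obtain u where "mset u = (\<Sum>c\<in>UNIV. replicate_mset (n c) c)"
    using ex_mset by blast
  then have "count_list u c = n c" for c
    by (subst count_mset[symmetric]) (simp add: count_sum)
  then show ?thesis
    by blast
qed

lemma lookup_complete_S:
  "Poly_Mapping.lookup (complete_S n) (cstd w) = of_bool (sorted (map fst w) \<and> count_list (map snd w) = n)"
proof -
  have "Poly_Mapping.lookup (complete_S n) (cstd w) = (\<Sum>u\<in>words_of_content n. if map snd w = u then of_bool (sorted (map fst w)) else 0)"
    unfolding complete_S_eq lookup_sum lookup_single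
    by (intro sum.cong) (auto simp: when_def cstd_eq_id_cperm_iff eq_commute[of "id_cperm _"])
  then show ?thesis
    unfolding sum.delta'[OF finite_words_of_content] by (auto simp: words_of_content_def)
qed

lemma complete_S_weight_0: "weight n = 0 \<Longrightarrow> complete_S n = fq_one"
proof -
  assume "weight n = 0"
  then have "words_of_content n = {[]}"
    by (auto simp: words_of_content_def weight_count_list) (auto simp: weight_def)
  then show ?thesis
    by (simp add: complete_S_eq fq_one_eq id_cperm_def)
qed

lemma
  assumes "i \<le> length u"
  shows low_id_cperm: "low i (id_cperm u) = id_cperm (take i u)"
    and high_id_cperm: "high i (id_cperm u) = id_cperm (drop i u)"
proof -
  \<comment> \<open>A constant word cannot be cut by value. In the representative
    \<open>1, ..., n\<close> a cut by value is a cut by position.\<close>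
  define w where "w = zip [1..<length u + 1] u"
  have u: "id_cperm u = cstd w"
    unfolding w_def by (rule sym) (simp add: cstd_eq_id_cperm_iff del: upt_Suc)
  have "\<forall>x\<in>set (take i w). fst x \<le> i" "\<forall>x\<in>set (drop i w). \<not> fst x \<le> i"
    by (auto simp: w_def in_set_conv_nth simp del: upt_Suc)
  then have "filter (\<lambda>x. fst x \<le> i) (take i w @ drop i w) = take i w"
    "filter (\<lambda>x. \<not> fst x \<le> i) (take i w @ drop i w) = drop i w"
    by (simp_all add: filter_empty_conv filter_id_conv del: append_take_drop_id)
  then have *: "filter (\<lambda>x. fst x \<le> i) w = take i w" "filter (\<lambda>x. \<not> fst x \<le> i) w = drop i w"
    by simp_all
  have len: "length (filter (\<lambda>x. fst x \<le> i) w) = i"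
    using assms unfolding * by (simp add: w_def del: upt_Suc)
  show "low i (id_cperm u) = id_cperm (take i u)" "high i (id_cperm u) = id_cperm (drop i u)"
    unfolding u low_cstd[OF len] high_cstd[OF len] * ctake_cstd[symmetric] cdrop_cstd[symmetric]
    unfolding u[symmetric] by (simp_all add: id_cperm_def ctake_cstd cdrop_cstd take_map drop_map)
qed

lemma finite_splittings: "finite {(i, j). \<forall>c. i c + j c = (n :: 'c::finite \<Rightarrow> nat) c}"
proof (rule finite_subset)
  let ?B = "\<Pi>\<^sub>E c\<in>UNIV. {..n c}"
  show "{(i, j). \<forall>c. i c + j c = n c} \<subseteq> ?B \<times> ?B"
    by (auto simp: PiE_def) (metis le_add1, metis le_add2)
  show "finite (?B \<times> ?B)"
    by (intro finite_cartesian_product finite_PiE) auto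
qed

lemma comult_complete_S:
  "\<Delta> (complete_S n) = (\<Sum>(i, j) \<in> {(i, j). \<forall>c. i c + j c = n c}. complete_S i \<otimes> complete_S j)"
proof -
  let ?s = "\<lambda>u v. Poly_Mapping.single (id_cperm u, id_cperm v) (1 :: complex)"
  let ?P = "{(i, j). \<forall>c. i c + j c = n c}"
  have "\<Delta> (complete_S n) = (\<Sum>u\<in>words_of_content n. \<Sum>k\<le>length u. ?s (take k u) (drop k u))"
    unfolding complete_S_eq vlinear_sum[OF vlinear_comult] comult_single
    by (intro sum.cong) (auto simp: id_cperm_def[of "_ :: _ list"] low_id_cperm[unfolded id_cperm_def] high_id_cperm[unfolded id_cperm_def])
  also have "\<dots> = (\<Sum>(u, k)\<in>(SIGMA u : words_of_content n. {..length u}). ?s (take k u) (drop k u))"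
    by (rule sum.Sigma) auto
  \<comment> \<open>A color word with a cut is a pair of color words whose contents add up to
    \<open>n\<close>; the length of the first one recovers the cut.\<close>
  also have "\<dots> = (\<Sum>((i, j), (u, v))\<in>(SIGMA (i, j) : ?P. words_of_content i \<times> words_of_content j). ?s u v)"
    by (rule sum.reindex_bij_witness[of _ "\<lambda>((i, j), (u, v)). (u @ v, length u)"
      "\<lambda>(u, k). ((count_list (take k u), count_list (drop k u)), (take k u, drop k u))"])
      (auto simp: words_of_content_def count_list_append[symmetric] fun_eq_iff)
  also have "\<dots> = (\<Sum>(i, j)\<in>?P. \<Sum>(u, v)\<in>words_of_content i \<times> words_of_content j. ?s u v)"
    using sum.Sigma[of ?P "\<lambda>(i, j). words_of_content i \<times> words_of_content j" "\<lambda>_ (u, v). ?s u v"]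
    by (simp add: case_prod_unfold finite_splittings[unfolded case_prod_unfold])
  also have "\<dots> = (\<Sum>(i, j)\<in>?P. complete_S i \<otimes> complete_S j)"
    unfolding complete_S_eq tensor_sum_left
    by (intro sum.cong refl) (auto simp: tensor_sum_right tensor_single sum.cartesian_product)
  finally show ?thesis .
qed

lemma twist_comult_complete_S: "twist (\<Delta> (complete_S n)) = \<Delta> (complete_S n)"
proof -
  have "twist (\<Delta> (complete_S n)) = (\<Sum>(i, j) \<in> {(i, j). \<forall>c. i c + j c = n c}. complete_S j \<otimes> complete_S i)"
    by (simp add: comult_complete_S vlinear_sum[OF vlinear_twist] case_prod_unfold twist_tensor)
  also have "\<dots> = \<Delta> (complete_S n)"
    unfolding comult_complete_S
    by (rule sum.reindex_bij_witness[of _ prod.swap prod.swap]) (auto simp: add.commute)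
  finally show ?thesis .
qed

section \<open>From the generators to Sym\<close>

lemma subalgebra_Sym: "subalgebra Sym"
  unfolding Sym_def by (rule subalgebra_hull)

lemma complete_S_in_Sym: "complete_S n \<in> Sym"
  unfolding Sym_def by (rule hull_inc) simp

lemma comult_Sym: "x \<in> Sym \<Longrightarrow> \<Delta> x \<in> tensor_space Sym Sym \<and> twist (\<Delta> x) = \<Delta> x"
proof -
  have "\<Delta> (complete_S n) \<in> tensor_space Sym Sym" for n :: "'a \<Rightarrow> nat"
    unfolding comult_complete_S
    by (rule vec.subspace_sum[OF subspace_tensor_space]) (auto intro: tensor_in_tensor_space complete_S_in_Sym)
  \<comment> \<open>The space \<open>tensor_space Sym Sym\<close> is kept fixed while minimality is
    applied to the remaining occurrence of \<open>Sym\<close>.\<close>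
  then have "Sym \<subseteq> {x :: 'a fqsym. \<Delta> x \<in> tensor_space Sym Sym \<and> twist (\<Delta> x) = \<Delta> x}"
    unfolding Sym_def[where 'c = 'a]
    by (intro hull_minimal) (auto simp: Sym_def[symmetric] twist_comult_complete_S
        intro!: subalgebra_cocommutative_comult subalgebra_Sym)
  then show "x \<in> Sym \<Longrightarrow> \<Delta> x \<in> tensor_space Sym Sym \<and> twist (\<Delta> x) = \<Delta> x"
    by blast
qed

lemma hopf_subalgebra_Sym: "hopf_subalgebra Sym"
  unfolding hopf_subalgebra_def
  using comult_Sym is_antipode_antipode antipode_in_subalgebra[OF subalgebra_Sym]
  by (auto simp: subalgebra_Sym image_subset_iff)

lemma cocommutative_Sym: "cocommutative Sym"
  by (simp add: cocommutative_def comult_Sym)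

section \<open>Freeness\<close>

text \<open>Letters are constant on a block and drop from one block to the next, so after
  standardization each block increases and the descents are exactly at the boundaries between
  nonempty blocks.\<close>

fun block_word :: "'c list list \<Rightarrow> (nat \<times> 'c) list" where
  "block_word [] = []"
| "block_word (u # us) = map (Pair (length us)) u @ block_word us"

lemma block_word_less: "x \<in> set (block_word us) \<Longrightarrow> fst x < length us"
  by (induction us) (auto simp: less_Suc_eq)

text \<open>
  A prefix that reaches beyond the first block contains a descent, so it does not contribute.
\<close>

lemma lookup_complete_S_mult_block:
  assumes "u \<noteq> []"
  shows "Poly_Mapping.lookup (complete_S n \<odot> y) (cstd (block_word (u # us))) =
    (\<Sum>k\<le>length u. of_bool (count_list (take k u) = n) *
       Poly_Mapping.lookup y (cstd (map (Pair (length us)) (drop k u) @ block_word us)))"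
proof -
  let ?w = "block_word (u # us)"
  have zero: "Poly_Mapping.lookup (complete_S n) (cstd (take k ?w)) = 0"
    if "length u < k" "k \<le> length ?w" for k
  proof -
    \<comment> \<open>The descent sits between the last letter of the first block, which exists
      since \<open>u\<close> is nonempty, and the first letter after it.\<close>
    have "fst (?w ! (length u - 1)) = length us"
      using assms by (simp add: nth_append)
    moreover have "block_word us \<noteq> []"
      using that by auto
    then have "?w ! length u \<in> set (block_word us)"
      by (simp add: nth_append)
    then have "fst (?w ! length u) < length us"
      by (rule block_word_less)
    moreover have "fst (?w ! (length u - 1)) \<le> fst (?w ! length u)" if "sorted (map fst (take k ?w))"
      using sorted_nth_mono[OF that, of "length u - 1" "length u"] \<open>length u < k\<close> \<open>k \<le> length ?w\<close>
      by (simp del: block_word.simps)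
    ultimately have "\<not> sorted (map fst (take k ?w))"
      by linarith
    then show ?thesis
      by (simp add: lookup_complete_S)
  qed
  have "Poly_Mapping.lookup (complete_S n \<odot> y) (cstd ?w) = (\<Sum>k\<le>length ?w.
      Poly_Mapping.lookup (complete_S n) (cstd (take k ?w)) * Poly_Mapping.lookup y (cstd (drop k ?w)))"
    by (simp only: lookup_mult csize_cstd ctake_cstd cdrop_cstd)
  also have "\<dots> = (\<Sum>k\<le>length u.
      Poly_Mapping.lookup (complete_S n) (cstd (take k ?w)) * Poly_Mapping.lookup y (cstd (drop k ?w)))"
    by (rule sum.mono_neutral_right) (auto simp del: block_word.simps simp: zero not_le, simp)
  also have "\<dots> = (\<Sum>k\<le>length u. of_bool (count_list (take k u) = n) *
       Poly_Mapping.lookup y (cstd (map (Pair (length us)) (drop k u) @ block_word us)))"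
    by (intro sum.cong refl arg_cong2[where f = "(*)"])
      (auto simp: lookup_complete_S take_map drop_map comp_def sorted_iff_nth_mono)
  finally show ?thesis .
qed

primrec complete_prod :: "('c::finite \<Rightarrow> nat) list \<Rightarrow> 'c fqsym" where
  "complete_prod [] = fq_one"
| "complete_prod (n # ns) = complete_S n \<odot> complete_prod ns"

text \<open>No factor can reach across a descent, so each uses letters of at most one block, and
  there are more nonempty blocks than factors.\<close>

lemma lookup_complete_prod_short:
  assumes "u \<noteq> []" "[] \<notin> set us" "length ns \<le> length us"
  shows "Poly_Mapping.lookup (complete_prod ns) (cstd (block_word (u # us))) = 0"
  using assms
proof (induction ns arbitrary: u us)
  case Nil
  then show ?case
    by (simp add: lookup_one)
next
  case (Cons n ns)
  have "Poly_Mapping.lookup (complete_prod ns) (cstd (map (Pair (length us)) (drop k u) @ block_word us)) = 0"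
    if "k \<le> length u" for k
  \<comment> \<open>If the factor uses up the first block, the number of factors and the number of
    blocks both drop by one. Otherwise the rest of the block becomes a new nonempty first block,
    with one factor fewer.\<close>
  proof (cases "k = length u")
    case True
    obtain u' us' where "us = u' # us'"
      using Cons.prems by (cases us) auto
    then show ?thesis
      using Cons.IH[of u' us'] Cons.prems True by auto
  next
    case False
    then show ?thesis
      using Cons.IH[of "drop k u" us] Cons.prems that by simp
  qed
  then show ?case
    unfolding complete_prod.simps lookup_complete_S_mult_block[OF Cons.prems(1)] by simp
qed

text \<open>With as many factors as blocks, every factor has to take a whole block, which fixes its
  content.\<close>

lemma lookup_complete_prod_block:
  assumes "[] \<notin> set us" "length ns \<le> length us"
  shows "Poly_Mapping.lookup (complete_prod ns) (cstd (block_word us)) = of_bool (ns = map count_list us)"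
  using assms
proof (induction us arbitrary: ns)
  case Nil
  then show ?case
    by (simp add: lookup_one)
next
  case (Cons u us)
  show ?case
  proof (cases "length ns \<le> length us")
    case True
    then show ?thesis
      using lookup_complete_prod_short[of u us ns] Cons.prems by auto
  next
    case False
    then obtain n ns' where ns: "ns = n # ns'" "length ns' = length us"
      using Cons.prems by (cases ns) auto
    \<comment> \<open>Stopping inside the first block leaves \<open>length us + 1\<close> nonempty
      blocks for \<open>length us\<close> factors, so only the full block survives.\<close>
    have "Poly_Mapping.lookup (complete_prod ns') (cstd (map (Pair (length us)) (drop k u) @ block_word us)) =
       (if k = length u then of_bool (ns' = map count_list us) else 0)" if "k \<le> length u" for k
      using lookup_complete_prod_short[of "drop k u" us ns'] Cons that ns by auto
    then have "Poly_Mapping.lookup (complete_prod ns) (cstd (block_word (u # us))) =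
        (\<Sum>k\<le>length u. if k = length u then of_bool (count_list (take k u) = n) * of_bool (ns' = map count_list us) else 0)"
      unfolding ns(1) complete_prod.simps using Cons.prems
      by (subst lookup_complete_S_mult_block) (auto intro!: sum.cong)
    then show ?thesis
      using ns by (auto simp: of_bool_def)
  qed
qed

text \<open>The free algebra has words in the functions themselves as its basis; injectivity
  translates equality of such words into equality of lists of indices.\<close>

lemma inj_complete_S: "inj complete_S"
proof (rule injI)
  fix n m :: "'a \<Rightarrow> nat" assume eq: "complete_S n = complete_S m"
  obtain u where u: "count_list u = n"
    using words_of_content_nonempty by blast
  have "Poly_Mapping.lookup (complete_S n) (id_cperm u) = 1"
    by (simp add: id_cperm_def lookup_complete_S u comp_def sorted_iff_nth_mono)
  then show "n = m"
    unfolding eq by (simp add: id_cperm_def lookup_complete_S u comp_def split: if_splits)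
qed

section \<open>Evaluation of the free algebra on the generators\<close>

definition word_prod :: "'c fqsym list \<Rightarrow> 'c fqsym" where
  "word_prod w = foldr (\<odot>) w fq_one"

lemma word_prod_append: "word_prod (v @ w) = word_prod v \<odot> word_prod w"
  by (induction v) (simp_all add: word_prod_def mult_assoc)

lemma word_prod_map_complete_S: "word_prod (map complete_S ns) = complete_prod ns"
  by (induction ns) (simp_all add: word_prod_def)

lemma vlinear_bilin_ext_left: "vlinear (\<lambda>x. bilin_ext f x y)"
  unfolding bilin_ext_def by (rule vlinear_lin_ext)

lemma vlinear_bilin_ext_right: "vlinear (bilin_ext f x)"
  by (rule vlinearI)
    (simp_all add: bilin_ext_def lin_ext_def[of _ x] vlinear_add[OF vlinear_lin_ext]
      vlinear_scale[OF vlinear_lin_ext] vec.scale_right_distrib sum.distrib vec.scale_sum_right mult.commute)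

lemma vlinear_comp: "vlinear f \<Longrightarrow> vlinear g \<Longrightarrow> vlinear (\<lambda>x. f (g x))"
  by (simp add: vlinear_iff)

lemma lin_ext_free_mult:
  assumes "\<And>v w. h (v @ w) = h v \<odot> h w"
  shows "lin_ext h (free_mult f g) = lin_ext h f \<odot> lin_ext h g"
  unfolding free_mult_def
proof (rule vlinear_eqI[of "\<lambda>f. lin_ext h (bilin_ext _ f g)" "\<lambda>f. lin_ext h f \<odot> lin_ext h g"])
  fix v
  show "lin_ext h (bilin_ext (\<lambda>v w. Poly_Mapping.single (v @ w) 1) (Poly_Mapping.single v 1) g) =
      lin_ext h (Poly_Mapping.single v 1) \<odot> lin_ext h g"
    by (rule vlinear_eqI[of "\<lambda>g. lin_ext h (bilin_ext _ _ g)" "\<lambda>g. lin_ext h _ \<odot> lin_ext h g"])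
      (auto intro!: vlinear_comp[OF vlinear_lin_ext vlinear_bilin_ext_right] vlinearI
        simp: bilin_ext_def lin_ext_single assms mult_simps vlinear_add[OF vlinear_lin_ext]
          vlinear_scale[OF vlinear_lin_ext])
qed (auto intro!: vlinear_comp[OF vlinear_lin_ext vlinear_bilin_ext_left] vlinearI
      simp: mult_simps vlinear_add[OF vlinear_lin_ext] vlinear_scale[OF vlinear_lin_ext])

lemma subspace_free_algebra: "vec.subspace (free_algebra X)"
proof -
  have "Poly_Mapping.keys (vscale c f) \<subseteq> Poly_Mapping.keys f" for c and f :: "'a list vec"
    by (auto simp: in_keys_iff lookup_vscale)
  moreover have "Poly_Mapping.keys (f + g) \<subseteq> Poly_Mapping.keys f \<union> Poly_Mapping.keys g" for f g :: "'a list vec"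
    by (rule Poly_Mapping.keys_add)
  ultimately show ?thesis
    unfolding free_algebra_def
    by (intro vec.subspaceI) (simp, simp_all only: mem_Collect_eq, blast+)
qed

lemma single_in_free_algebra: "w \<in> lists X \<Longrightarrow> Poly_Mapping.single w c \<in> free_algebra X"
  by (simp add: free_algebra_def)

lemma free_mult_in_free_algebra:
  assumes "f \<in> free_algebra X" "g \<in> free_algebra X"
  shows "free_mult f g \<in> free_algebra X"
  unfolding free_mult_def bilin_ext_def lin_ext_def using assms
  by (intro vec.subspace_sum vec.subspace_scale subspace_free_algebra single_in_free_algebra)
    (auto simp: free_algebra_def)

text \<open>A word of maximal length in the support of \<open>h\<close> acts as leading term: every
  word of the support is short enough for \<open>lookup_complete_prod_block\<close>, so one
  coefficient of the image equals that of the leading word.\<close>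

lemma lin_ext_word_prod_eq_0:
  fixes h :: "'c::finite fqsym list vec"
  assumes h: "h \<in> free_algebra {complete_S n |n. weight n > 0}" and 0: "lin_ext word_prod h = 0"
  shows "h = 0"
proof (rule ccontr)
  assume "h \<noteq> 0"
  then have "Max (length ` Poly_Mapping.keys h) \<in> length ` Poly_Mapping.keys h"
    by (intro Max_in) auto
  then obtain w where w: "w \<in> Poly_Mapping.keys h" "length w = Max (length ` Poly_Mapping.keys h)"
    by auto
  have max: "length v \<le> length w" if "v \<in> Poly_Mapping.keys h" for v
    using that unfolding w(2) by simp
  have keys: "\<exists>ns. v = map complete_S ns \<and> (\<forall>n\<in>set ns. weight n > 0)" if "v \<in> Poly_Mapping.keys h" for v
  proof -
    have "v \<in> lists (complete_S ` {n. weight n > 0})"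
      using h that by (auto simp: free_algebra_def image_def)
    then show ?thesis
      unfolding lists_image by (auto simp: in_lists_conv_set)
  qed
  obtain ns where ns: "w = map complete_S ns" "\<forall>n\<in>set ns. weight n > 0"
    using keys[OF w(1)] by blast
  \<comment> \<open>Any color words with the contents \<open>ns\<close> serve as blocks; they are
    nonempty because the weights are positive.\<close>
  obtain us where us: "map count_list us = ns"
    using words_of_content_nonempty ex_map_conv[of ns count_list] by metis
  have "[] \<notin> set us"
    using ns us by (force simp: weight_count_list)
  have "Poly_Mapping.lookup (word_prod v) (cstd (block_word us)) = of_bool (w = v)" if v: "v \<in> Poly_Mapping.keys h" for v
  proof -
    obtain ms where ms: "v = map complete_S ms"
      using keys[OF v] by blast
    have "length ms \<le> length us"
      using max[OF v] by (simp add: ms ns us[symmetric])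
    then show ?thesis
      using lookup_complete_prod_block[OF \<open>[] \<notin> set us\<close>, of ms]
      by (auto simp: ms ns(1) us word_prod_map_complete_S inj_map_eq_map[OF inj_complete_S])
  qed
  then have "Poly_Mapping.lookup (lin_ext word_prod h) (cstd (block_word us)) =
      (\<Sum>v\<in>Poly_Mapping.keys h. Poly_Mapping.lookup h v * of_bool (w = v))"
    unfolding lin_ext_def lookup_sum lookup_vscale by (intro sum.cong) simp_all
  then have "Poly_Mapping.lookup h w = 0"
    unfolding 0 lookup_sum_of_bool by simp
  then show False
    using w(1) by (simp add: in_keys_iff)
qed

lemma image_lin_ext_word_prod:
  "lin_ext word_prod ` free_algebra {complete_S n |n. weight n > 0} = (Sym :: 'c::finite fqsym set)"
    (is "?\<phi> ` free_algebra ?X = Sym")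
proof
  have "word_prod w \<in> Sym" if "w \<in> lists ?X" for w
    using that subalgebra_Sym complete_S_in_Sym
    by (induction w) (auto simp: word_prod_def subalgebra_def)
  then show "?\<phi> ` free_algebra ?X \<subseteq> Sym"
    using subalgebra_Sym unfolding lin_ext_def
    by (auto simp: free_algebra_def subalgebra_def intro!: vec.subspace_sum vec.subspace_scale)
next
  have one: "?\<phi> (Poly_Mapping.single [] 1) = fq_one"
    by (simp add: lin_ext_single word_prod_def)
  have gen: "complete_S n \<in> ?\<phi> ` free_algebra ?X" for n :: "'c \<Rightarrow> nat"
  \<comment> \<open>The index of weight 0 gives no free generator; its function is the unit and is
    the image of the empty word.\<close>
  proof (cases "weight n = 0")
    case True
    then show ?thesis
      using one by (intro image_eqI[of _ _ "Poly_Mapping.single [] 1"])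
        (auto simp: complete_S_weight_0 intro: single_in_free_algebra)
  next
    case False
    then show ?thesis
      by (intro image_eqI[of _ _ "Poly_Mapping.single [complete_S n] 1"])
        (auto simp: lin_ext_single word_prod_def intro!: single_in_free_algebra)
  qed
  have "subalgebra (?\<phi> ` free_algebra ?X)"
    unfolding subalgebra_def
  proof (intro conjI ballI)
    show "vec.subspace (?\<phi> ` free_algebra ?X)"
    proof (rule vec.subspaceI)
      show "0 \<in> ?\<phi> ` free_algebra ?X"
        using vlinear_0[OF vlinear_lin_ext] by (intro image_eqI[of _ _ 0]) (auto simp: vec.subspace_0 subspace_free_algebra)
      show "x + y \<in> ?\<phi> ` free_algebra ?X" if "x \<in> ?\<phi> ` free_algebra ?X" "y \<in> ?\<phi> ` free_algebra ?X" for x y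
        using that by (auto simp: vlinear_add[OF vlinear_lin_ext, symmetric]
            intro!: imageI vec.subspace_add[OF subspace_free_algebra])
      show "vscale c x \<in> ?\<phi> ` free_algebra ?X" if "x \<in> ?\<phi> ` free_algebra ?X" for c x
        using that by (auto simp: vlinear_scale[OF vlinear_lin_ext, symmetric]
            intro!: imageI vec.subspace_scale[OF subspace_free_algebra])
    qed
    show "fq_one \<in> ?\<phi> ` free_algebra ?X"
      unfolding one[symmetric] by (intro imageI single_in_free_algebra) simp
    show "x \<odot> y \<in> ?\<phi> ` free_algebra ?X" if "x \<in> ?\<phi> ` free_algebra ?X" "y \<in> ?\<phi> ` free_algebra ?X" for x y
      using that by (auto simp: lin_ext_free_mult[symmetric] word_prod_append intro!: free_mult_in_free_algebra)
  qed
  then show "Sym \<subseteq> ?\<phi> ` free_algebra ?X"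
    unfolding Sym_def using gen by (intro hull_minimal) auto
qed

lemma free_over_Sym: "free_over Sym {complete_S n |n. weight n > 0}"
proof -
  let ?\<phi> = "lin_ext word_prod" and ?F = "free_algebra {complete_S n |n. weight n > 0}"
  have "inj_on ?\<phi> ?F"
  proof (rule inj_onI)
    fix f g assume fg: "f \<in> ?F" "g \<in> ?F" "?\<phi> f = ?\<phi> g"
    have "?\<phi> f = ?\<phi> (f - g) + ?\<phi> g"
      by (subst vlinear_add[OF vlinear_lin_ext, symmetric]) simp
    then have "?\<phi> (f - g) = 0"
      using fg(3) by simp
    then show "f = g"
      using lin_ext_word_prod_eq_0[OF vec.subspace_diff[OF subspace_free_algebra fg(1,2)]] by simp
  qed
  then have "bij_betw ?\<phi> ?F Sym"
    by (simp add: bij_betw_def image_lin_ext_word_prod)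
  moreover have "vlinear ?\<phi>"
    by (rule vlinear_lin_ext)
  moreover have "?\<phi> (Poly_Mapping.single [] 1) = fq_one" "?\<phi> (Poly_Mapping.single [x] 1) = x" for x :: "'a fqsym"
    by (simp_all add: lin_ext_single word_prod_def)
  ultimately show ?thesis
    unfolding free_over_def
    by (intro exI[of _ ?\<phi>]) (auto simp: lin_ext_free_mult[of word_prod] word_prod_append)
qed

theorem theorem3p1:
  shows "free_over (Sym :: 'c::finite fqsym set) {complete_S n |n. weight n > 0} \<and>
    inj_on (complete_S :: ('c \<Rightarrow> nat) \<Rightarrow> 'c fqsym) {n. weight n > 0} \<and>
    hopf_subalgebra (Sym :: 'c fqsym set) \<and>
    (\<forall>n :: 'c \<Rightarrow> nat. \<Delta> (complete_S n) =
       (\<Sum>(i, j) \<in> {(i, j). \<forall>c. i c + j c = n c}. complete_S i \<otimes> complete_S j)) \<and>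
    cocommutative (Sym :: 'c fqsym set)"
  using free_over_Sym inj_complete_S hopf_subalgebra_Sym comult_complete_S cocommutative_Sym
  by (blast intro: inj_on_subset)

end
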